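(* Let $(A,\theta)$ be an independence alphabet, let $\mathcal F=(\{l_i\})_{i\in I}$ be a complete locally transitive finite factorization of $M(A,\theta)$ and let $\Pi$ be a bracketing of $\mathcal F$. Then the family $(\Pi(l_i))_{i\in I}$ is a basis of $L_K(A,\theta)$ as a $K$-module.
   Context: Independence alphabets and TFSA. An independence alphabet $(A,\theta)$ is a set $A$ with a symmetric, antireflexive relation $\theta$. $M(A,\theta)=\langle A\mid ab=ba,\ (a,b)\in\theta\rangle$ is the free partially commutative monoid (elements: traces). $\mathrm{Alph}(t)$ is the set of letters of $t$; $IA(t)=\{a\in A\mid t=aw\text{ for some }w\}$. For $X\subset M(A,\theta)$, $\langle X\rangle$ is the submonoid generated by $X$ and $\theta_X=\{(x_1,x_2)\in X^2\mid\mathrm{Alph}(x_1)\times\mathrm{Alph}(x_2)\subset\theta\}$. $X$ is a partially commutative code if $M(X,\theta_X)\to\langle X\rangle$ is an isomorphism; then $\langle X\rangle$ is identified with $M(X,\theta_X)$. For $B\subset A$, $Z=A\setminus B$, $\beta_Z(B)=\{zw\mid z\in Z,\ w\in M(B,\theta_B),\ IA(zw)=\{z\}\}$; $B$ is a TFSA of $(A,\theta)$ if $\beta_Z(B)$ is a partially commutative code. The same notions are used with an independence alphabet $(Y,\theta_Y)$, $Y$ a partially commutative code, in place of $(A,\theta)$. Factorizations. A factorization of a monoid $M$ is a family $(M_i)_{i\in J}$ of submonoids, $J$ totally ordered, such that every $m\ne1$ in $M$ is uniquely $m=m_{i_1}\cdots m_{i_n}$ with $i_1<\dots<i_n$ and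 $m_{i_k}\in M_{i_k}\setminus\{1\}$. For $M=M(A,\theta)$ it is denoted by the family $(Y_i)_{i\in J}$ of minimal generating sets of its components, $M_i=\langle Y_i\rangle$; $\mathrm{Cont}\,\mathcal F=\bigcup_iY_i$. It is complete if each $Y_i$ is a singleton. A factorization with two components is a bisection. If $\mathcal F'$ is a factorization of a component $M_k$ of $\mathcal F$, the composition $\mathcal F'\circ\mathcal F$ is obtained by replacing $M_k$ in $\mathcal F$ by the ordered family $\mathcal F'$. A transitive bisection of $M(A,\theta)$ is $(B,\beta_{A\setminus B}(B))$ with $B$ a TFSA of $A$. A (finite) transitive factorization is one obtained by composing finitely many (possibly zero) transitive bisections. Locally transitive finite. For finite $B\subset A$ and $n\ge0$, $B^{\le n}$ is the set of traces of length $\le n$ over $B$. A factorization $\mathcal F=(Y_i)_{i\in I}$ of $M(A,\theta)$ is locally transitive finite if for all finite $B\subset A$ and $n\ge0$ there are a finite transitive factorization $(Y'_i)_{i\in I'}$ of $M(A,\theta)$ and a strictly increasing $\phi:I'\to I$ with $Y'_i\cap B^{\le n}=Y_{\phi(i)}\cap B^{\le n}$ for all $i\in I'$ and $Y_j\cap B^{\le n}=\emptyset$ for $j\notin\phi(I')$; call $(Y'_i)$ a local model of $\mathcal F$ at $(n,B)$. Lie algebra. $K$ is a commutative ring with $1\neq0$; $L_K(A,\theta)$ is the Lie subalgebra of $K[M(A,\theta)]$ (commutator bracket) generated by the letters, i.e. the free partially commutative Lie algebra. Bracketing of a finite transitive factorization. For a transitive factorization $\mathcal F=(Y_1,\dots,Y_{n+1})$,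 $\widetilde{\mathcal F}$ is the set of tuples $\mathfrak f=(\mathbb B_1,\dots,\mathbb B_n)$ of transitive bisections with $\mathcal F=\mathbb B_n\circ\dots\circ\mathbb B_1$. For $\mathfrak f\in\widetilde{\mathcal F}$, $\Pi_{\mathfrak f}:\mathrm{Cont}\,\mathcal F\to L_K(A,\theta)$ is defined inductively. For $n=0$ (empty tuple), $\Pi_{\mathfrak f}(a)=a$ for $a\in A$. For $n\ge1$ let $\mathfrak f'=(\mathbb B_1,\dots,\mathbb B_{n-1})$, $\mathbb B_{n-1}\circ\dots\circ\mathbb B_1=(Y'_1,\dots,Y'_n)$ and $\mathbb B_n=(Y''_j,\beta_{Y'_j\setminus Y''_j}(Y''_j))$ a bisection of $\langle Y'_j\rangle$. Then $\Pi_{\mathfrak f}(w)=\Pi_{\mathfrak f'}(w)$ if $w\in\bigcup_iY'_i$, and $\Pi_{\mathfrak f}(w)=[\dots[\Pi_{\mathfrak f'}(y),\Pi_{\mathfrak f'}(v_1)],\dots,\Pi_{\mathfrak f'}(v_k)]$ if $w=yv_1\cdots v_k\in\beta_{Y'_j\setminus Y''_j}(Y''_j)$ with $y\in Y'_j\setminus Y''_j$, $v_1,\dots,v_k\in Y''_j$. Bracketing in the local case. A bracketing of a locally transitive finite factorization $\mathcal F$ is a map $\Pi:\mathrm{Cont}\,\mathcal F\to L_K(A,\theta)$ such that for each finite $B\subset A$ and each $n\ge0$ there exist a local model $\mathcal F_{n,B}$ of $\mathcal F$ at $(n,B)$ and $\mathfrak f_{n,B}\in\widetilde{\mathcal F}_{n,B}$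 such that $\Pi(t)=\Pi_{\mathfrak f_{n,B}}(t)$ for all $t\in\mathrm{Cont}\,\mathcal F_{n,B}\cap B^{\le n}$. *)

theory Defs
  imports Complex_Main "HOL-Algebra.Group" "HOL-Library.Poly_Mapping"
begin

section \<open>Free partially commutative monoids\<close>

definition independence_alphabet :: "'a set \<Rightarrow> ('a \<times> 'a) set \<Rightarrow> bool" where
  "independence_alphabet A \<theta> \<longleftrightarrow> \<theta> \<subseteq> A \<times> A \<and> sym \<theta> \<and> irrefl \<theta>"

inductive trace_eq :: "('a \<times> 'a) set \<Rightarrow> 'a list \<Rightarrow> 'a list \<Rightarrow> bool" for \<theta> where
  refl: "trace_eq \<theta> u u"
| sym: "trace_eq \<theta> u v \<Longrightarrow> trace_eq \<theta> v u"
| trans: "trace_eq \<theta> u v \<Longrightarrow> trace_eq \<theta> v w \<Longrightarrow> trace_eq \<theta> u w"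
| append: "trace_eq \<theta> u u' \<Longrightarrow> trace_eq \<theta> v v' \<Longrightarrow> trace_eq \<theta> (u @ v) (u' @ v')"
| commute: "(a, b) \<in> \<theta> \<Longrightarrow> trace_eq \<theta> [a, b] [b, a]"

type_synonym 'a trace = "'a list set"

definition trace_of :: "('a \<times> 'a) set \<Rightarrow> 'a list \<Rightarrow> 'a trace" where
  "trace_of \<theta> u = {v. trace_eq \<theta> u v}"

definition trace_monoid :: "'a set \<Rightarrow> ('a \<times> 'a) set \<Rightarrow> 'a trace monoid" where
  "trace_monoid A \<theta> =
    \<lparr>carrier = trace_of \<theta> ` lists A,
     mult = (\<lambda>s t. \<Union>u\<in>s. \<Union>v\<in>t. trace_of \<theta> (u @ v)),
     one = trace_of \<theta> []\<rparr>"

definition letters :: "'a set \<Rightarrow> ('a \<times> 'a) set \<Rightarrow> 'a trace set" where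
  "letters A \<theta> = (\<lambda>a. trace_of \<theta> [a]) ` A"

definition Alph :: "'a trace \<Rightarrow> 'a set" where
  "Alph t = (\<Union>u\<in>t. set u)"

definition IA :: "'a set \<Rightarrow> ('a \<times> 'a) set \<Rightarrow> 'a trace \<Rightarrow> 'a set" where
  "IA A \<theta> t = {a \<in> A. \<exists>w \<in> carrier (trace_monoid A \<theta>).
     t = trace_of \<theta> [a] \<otimes>\<^bsub>trace_monoid A \<theta>\<^esub> w}"

definition traces_upto :: "('a \<times> 'a) set \<Rightarrow> 'a set \<Rightarrow> nat \<Rightarrow> 'a trace set" where
  "traces_upto \<theta> B n = trace_of \<theta> ` {u \<in> lists B. length u \<le> n}"


section \<open>Generated submonoids and partially commutative codes\<close>

definition list_prod :: "('m, 'r) monoid_scheme \<Rightarrow> 'm list \<Rightarrow> 'm" where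
  "list_prod G xs = foldr (\<otimes>\<^bsub>G\<^esub>) xs \<one>\<^bsub>G\<^esub>"

definition gen_submonoid :: "('m, 'r) monoid_scheme \<Rightarrow> 'm set \<Rightarrow> 'm set" where
  "gen_submonoid G X = list_prod G ` lists X"

definition minimal_generators :: "('m, 'r) monoid_scheme \<Rightarrow> 'm set \<Rightarrow> bool" where
  "minimal_generators G X \<longleftrightarrow>
    X \<subseteq> carrier G \<and> (\<forall>X'. X' \<subset> X \<longrightarrow> gen_submonoid G X' \<noteq> gen_submonoid G X)"

definition induced_indep :: "('a \<times> 'a) set \<Rightarrow> 'a trace set \<Rightarrow> ('a trace \<times> 'a trace) set" where
  "induced_indep \<theta> X = {(x1, x2). x1 \<in> X \<and> x2 \<in> X \<and> Alph x1 \<times> Alph x2 \<subseteq> \<theta>}"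

text \<open>The canonical morphism from \<open>trace_monoid X (induced_indep \<theta> X)\<close> to \<open>trace_monoid A \<theta>\<close>.
  All words \<open>xs\<close> in a trace over \<open>X\<close> have the same product, so the image below is a singleton.\<close>

definition trace_eval :: "'a set \<Rightarrow> ('a \<times> 'a) set \<Rightarrow> 'a trace trace \<Rightarrow> 'a trace" where
  "trace_eval A \<theta> T = the_elem (list_prod (trace_monoid A \<theta>) ` T)"

definition pc_code :: "'a set \<Rightarrow> ('a \<times> 'a) set \<Rightarrow> 'a trace set \<Rightarrow> bool" where
  "pc_code A \<theta> X \<longleftrightarrow>
    X \<subseteq> carrier (trace_monoid A \<theta>) \<and>
    trace_eval A \<theta> \<in> iso (trace_monoid X (induced_indep \<theta> X))
      (trace_monoid A \<theta>\<lparr>carrier := gen_submonoid (trace_monoid A \<theta>) X\<rparr>)"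


section \<open>Transitively factorizing subalphabets\<close>

text \<open>For \<open>B \<subseteq> A\<close>, \<open>beta A \<theta> B\<close> is \<open>\<beta>\<^sub>Z(B)\<close> with \<open>Z = A - B\<close>. The monoid \<open>M(B, \<theta>\<^sub>B)\<close> is literally
  a subset of \<open>M(A, \<theta>)\<close> in this encoding, because the congruence class of a word over \<open>B\<close>
  only contains words over \<open>B\<close>.\<close>

definition beta :: "'a set \<Rightarrow> ('a \<times> 'a) set \<Rightarrow> 'a set \<Rightarrow> 'a trace set" where
  "beta A \<theta> B =
    {trace_of \<theta> [z] \<otimes>\<^bsub>trace_monoid A \<theta>\<^esub> w | z w.
      z \<in> A - B \<and> w \<in> carrier (trace_monoid B (\<theta> \<inter> B \<times> B)) \<and>
      IA A \<theta> (trace_of \<theta> [z] \<otimes>\<^bsub>trace_monoid A \<theta>\<^esub> w) = {z}}"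

definition TFSA :: "'a set \<Rightarrow> ('a \<times> 'a) set \<Rightarrow> 'a set \<Rightarrow> bool" where
  "TFSA A \<theta> B \<longleftrightarrow> B \<subseteq> A \<and> pc_code A \<theta> (beta A \<theta> B)"

text \<open>A transitive bisection of the submonoid generated by a partially commutative code \<open>Y\<close> of
  \<open>M(A, \<theta>)\<close> is encoded by the pair \<open>(Y, B)\<close>, where \<open>B\<close> is a TFSA of the independence alphabet
  \<open>(Y, \<theta>\<^sub>Y)\<close>; its components are \<open>B\<close> and \<open>beta_in A \<theta> Y B\<close>, the image of \<open>\<beta>\<^sub>Z(B)\<close>,
  \<open>Z = Y - B\<close>, under the identification of \<open>M(Y, \<theta>\<^sub>Y)\<close> with the submonoid generated by \<open>Y\<close>.
  The monoid \<open>M(A, \<theta>)\<close> itself is the case \<open>Y = letters A \<theta>\<close>.\<close>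

definition beta_in :: "'a set \<Rightarrow> ('a \<times> 'a) set \<Rightarrow> 'a trace set \<Rightarrow> 'a trace set \<Rightarrow> 'a trace set" where
  "beta_in A \<theta> Y B = trace_eval A \<theta> ` beta Y (induced_indep \<theta> Y) B"

definition transitive_bisection ::
  "'a set \<Rightarrow> ('a \<times> 'a) set \<Rightarrow> 'a trace set \<times> 'a trace set \<Rightarrow> bool" where
  "transitive_bisection A \<theta> = (\<lambda>(Y, B). pc_code A \<theta> Y \<and> TFSA Y (induced_indep \<theta> Y) B)"


section \<open>Factorizations\<close>

definition factorization ::
  "('m, 'r) monoid_scheme \<Rightarrow> 'i::linorder set \<Rightarrow> ('i \<Rightarrow> 'm set) \<Rightarrow> bool" where
  "factorization G J N \<longleftrightarrow>
    (\<forall>i\<in>J. submonoid (N i) G) \<and>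
    (\<forall>m \<in> carrier G - {\<one>\<^bsub>G\<^esub>}.
      \<exists>!ms. sorted_wrt (<) (map fst ms) \<and>
            (\<forall>(i, x) \<in> set ms. i \<in> J \<and> x \<in> N i - {\<one>\<^bsub>G\<^esub>}) \<and>
            m = list_prod G (map snd ms))"

definition trace_factorization ::
  "'a set \<Rightarrow> ('a \<times> 'a) set \<Rightarrow> 'i::linorder set \<Rightarrow> ('i \<Rightarrow> 'a trace set) \<Rightarrow> bool" where
  "trace_factorization A \<theta> I Y \<longleftrightarrow>
    (\<forall>i\<in>I. minimal_generators (trace_monoid A \<theta>) (Y i)) \<and>
    factorization (trace_monoid A \<theta>) I (\<lambda>i. gen_submonoid (trace_monoid A \<theta>) (Y i))"

text \<open>\<open>bisections_compose A \<theta> f Ys\<close>: the list \<open>f = [\<BB>\<^sub>n, \<dots>, \<BB>\<^sub>1]\<close> consists of transitive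
  bisections whose composition \<open>\<BB>\<^sub>n \<circ> \<dots> \<circ> \<BB>\<^sub>1\<close> is the family \<open>Ys\<close>.\<close>

inductive bisections_compose ::
  "'a set \<Rightarrow> ('a \<times> 'a) set \<Rightarrow> ('a trace set \<times> 'a trace set) list \<Rightarrow> 'a trace set list \<Rightarrow> bool"
  for A \<theta> where
  Nil: "bisections_compose A \<theta> [] [letters A \<theta>]"
| Cons: "bisections_compose A \<theta> f (Ls @ Y # Rs) \<Longrightarrow> transitive_bisection A \<theta> (Y, B) \<Longrightarrow>
    bisections_compose A \<theta> ((Y, B) # f) (Ls @ [B, beta_in A \<theta> Y B] @ Rs)"

definition finite_transitive_factorization ::
  "'a set \<Rightarrow> ('a \<times> 'a) set \<Rightarrow> 'a trace set list \<Rightarrow> bool" where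
  "finite_transitive_factorization A \<theta> Ys \<longleftrightarrow> (\<exists>f. bisections_compose A \<theta> f Ys)"

definition local_model ::
  "'a set \<Rightarrow> ('a \<times> 'a) set \<Rightarrow> 'i::linorder set \<Rightarrow> ('i \<Rightarrow> 'a trace set) \<Rightarrow>
   nat \<Rightarrow> 'a set \<Rightarrow> 'a trace set list \<Rightarrow> bool" where
  "local_model A \<theta> I Y n B Ys \<longleftrightarrow>
    finite_transitive_factorization A \<theta> Ys \<and>
    (\<exists>\<phi>. \<phi> ` {..<length Ys} \<subseteq> I \<and> strict_mono_on {..<length Ys} \<phi> \<and>
      (\<forall>i<length Ys. Ys ! i \<inter> traces_upto \<theta> B n = Y (\<phi> i) \<inter> traces_upto \<theta> B n) \<and>
      (\<forall>j \<in> I - \<phi> ` {..<length Ys}. Y j \<inter> traces_upto \<theta> B n = {}))"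

definition locally_transitive_finite ::
  "'a set \<Rightarrow> ('a \<times> 'a) set \<Rightarrow> 'i::linorder set \<Rightarrow> ('i \<Rightarrow> 'a trace set) \<Rightarrow> bool" where
  "locally_transitive_finite A \<theta> I Y \<longleftrightarrow>
    trace_factorization A \<theta> I Y \<and>
    (\<forall>B n. finite B \<and> B \<subseteq> A \<longrightarrow> (\<exists>Ys. local_model A \<theta> I Y n B Ys))"


section \<open>Monoid algebras and the free partially commutative Lie algebra\<close>

text \<open>Elements of \<open>K[G]\<close> are the finitely supported functions with \<open>Poly_Mapping.keys\<close> in
  \<open>carrier G\<close>. The ring structure on \<open>poly_mapping\<close> is not usable, since the product of \<open>G\<close>
  is not given by a type class.\<close>

definition pm_scale :: "'k::comm_ring_1 \<Rightarrow> ('m \<Rightarrow>\<^sub>0 'k) \<Rightarrow> ('m \<Rightarrow>\<^sub>0 'k)" where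
  "pm_scale c p = Poly_Mapping.map ((*) c) p"

interpretation pm: module pm_scale
proof
  have lookup_scale: "Poly_Mapping.lookup (pm_scale c p) m = c * Poly_Mapping.lookup p m"
    for c :: "'k::comm_ring_1" and p :: "'m \<Rightarrow>\<^sub>0 'k" and m
    by (simp add: pm_scale_def Poly_Mapping.map.rep_eq when_def)
  fix a b :: "'k::comm_ring_1" and x y :: "'m \<Rightarrow>\<^sub>0 'k"
  show "pm_scale a (x + y) = pm_scale a x + pm_scale a y"
    by (rule poly_mapping_eqI) (simp add: lookup_scale lookup_add algebra_simps)
  show "pm_scale (a + b) x = pm_scale a x + pm_scale b x"
    by (rule poly_mapping_eqI) (simp add: lookup_scale lookup_add algebra_simps)
  show "pm_scale a (pm_scale b x) = pm_scale (a * b) x"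
    by (rule poly_mapping_eqI) (simp add: lookup_scale algebra_simps)
  show "pm_scale 1 x = x"
    by (rule poly_mapping_eqI) (simp add: lookup_scale)
qed

definition monoid_algebra :: "('m, 'r) monoid_scheme \<Rightarrow> ('m \<Rightarrow>\<^sub>0 'k::comm_ring_1) set" where
  "monoid_algebra G = {p. Poly_Mapping.keys p \<subseteq> carrier G}"

definition alg_mult ::
  "('m, 'r) monoid_scheme \<Rightarrow> ('m \<Rightarrow>\<^sub>0 'k::comm_ring_1) \<Rightarrow> ('m \<Rightarrow>\<^sub>0 'k) \<Rightarrow> ('m \<Rightarrow>\<^sub>0 'k)" where
  "alg_mult G p q = (\<Sum>s\<in>Poly_Mapping.keys p. \<Sum>t\<in>Poly_Mapping.keys q.
     Poly_Mapping.single (s \<otimes>\<^bsub>G\<^esub> t) (Poly_Mapping.lookup p s * Poly_Mapping.lookup q t))"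

definition lie_bracket ::
  "('m, 'r) monoid_scheme \<Rightarrow> ('m \<Rightarrow>\<^sub>0 'k::comm_ring_1) \<Rightarrow> ('m \<Rightarrow>\<^sub>0 'k) \<Rightarrow> ('m \<Rightarrow>\<^sub>0 'k)" where
  "lie_bracket G p q = alg_mult G p q - alg_mult G q p"

definition lie_subalgebra ::
  "('m, 'r) monoid_scheme \<Rightarrow> ('m \<Rightarrow>\<^sub>0 'k::comm_ring_1) set \<Rightarrow> bool" where
  "lie_subalgebra G S \<longleftrightarrow>
    S \<subseteq> monoid_algebra G \<and> pm.subspace S \<and> (\<forall>p\<in>S. \<forall>q\<in>S. lie_bracket G p q \<in> S)"

definition free_pc_lie :: "'a set \<Rightarrow> ('a \<times> 'a) set \<Rightarrow> ('a trace \<Rightarrow>\<^sub>0 'k::comm_ring_1) set" where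
  "free_pc_lie A \<theta> = lie_subalgebra (trace_monoid A \<theta>) hull
     ((\<lambda>t. Poly_Mapping.single t 1) ` letters A \<theta>)"

definition family_basis ::
  "'i set \<Rightarrow> ('i \<Rightarrow> ('m \<Rightarrow>\<^sub>0 'k::comm_ring_1)) \<Rightarrow> ('m \<Rightarrow>\<^sub>0 'k) set \<Rightarrow> bool" where
  "family_basis I b L \<longleftrightarrow> inj_on b I \<and> pm.independent (b ` I) \<and> pm.span (b ` I) = L"


section \<open>Bracketings\<close>

text \<open>\<open>finite_bracketing A \<theta> [\<BB>\<^sub>n, \<dots>, \<BB>\<^sub>1]\<close> is \<open>\<Pi>\<^sub>\<ff>\<close> for \<open>\<ff> = (\<BB>\<^sub>1, \<dots>, \<BB>\<^sub>n)\<close>, meaningful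
  on the contents of the composition \<open>\<BB>\<^sub>n \<circ> \<dots> \<circ> \<BB>\<^sub>1\<close> only. In the second branch
  \<open>w = y v\<^sub>1 \<dots> v\<^sub>k\<close> may have several decompositions, differing by commutations of the
  \<open>v\<^sub>i\<close>; they all give the same iterated bracket, as independent \<open>v\<^sub>i\<close> have
  commuting images. Hence the description determines the value.\<close>

fun finite_bracketing ::
  "'a set \<Rightarrow> ('a \<times> 'a) set \<Rightarrow> ('a trace set \<times> 'a trace set) list \<Rightarrow>
   'a trace \<Rightarrow> ('a trace \<Rightarrow>\<^sub>0 'k::comm_ring_1)" where
  "finite_bracketing A \<theta> [] w = Poly_Mapping.single w 1"
| "finite_bracketing A \<theta> ((Y, B) # f) w =
    (if \<exists>Ys. bisections_compose A \<theta> f Ys \<and> w \<in> \<Union>(set Ys)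
     then finite_bracketing A \<theta> f w
     else THE p. \<exists>y \<in> Y - B. \<exists>vs \<in> lists B.
       w = list_prod (trace_monoid A \<theta>) (y # vs) \<and>
       p = foldl (lie_bracket (trace_monoid A \<theta>))
             (finite_bracketing A \<theta> f y) (map (finite_bracketing A \<theta> f) vs))"

definition bracketing ::
  "'a set \<Rightarrow> ('a \<times> 'a) set \<Rightarrow> 'i::linorder set \<Rightarrow> ('i \<Rightarrow> 'a trace set) \<Rightarrow>
   ('a trace \<Rightarrow> ('a trace \<Rightarrow>\<^sub>0 'k::comm_ring_1)) \<Rightarrow> bool" where
  "bracketing A \<theta> I Y P \<longleftrightarrow>
    (\<forall>t \<in> (\<Union>i\<in>I. Y i). P t \<in> free_pc_lie A \<theta>) \<and>
    (\<forall>B n. finite B \<and> B \<subseteq> A \<longrightarrow>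
      (\<exists>Ys f. local_model A \<theta> I Y n B Ys \<and> bisections_compose A \<theta> f Ys \<and>
        (\<forall>t \<in> \<Union>(set Ys) \<inter> traces_upto \<theta> B n. P t = finite_bracketing A \<theta> f t)))"

end

theory Submission
  imports Defs "HOL-Library.Multiset" "Jordan_Normal_Form.Determinant"
begin

text \<open>
A basis needs generation and independence; the two halves rest on different parts of the
hypotheses, and a truncation to finitely many traces makes both of them finite questions.
Every element \<open>\<Pi>(l\<^sub>i)\<close> is multihomogeneous: the traces in its support have the same letters with the
same multiplicities as \<open>l\<^sub>i\<close> (\<open>bracketing_homogeneous\<close>). Hence cutting an element down to the traces of
bounded length over a finite alphabet either keeps \<open>\<Pi>(l\<^sub>i)\<close> or kills it.

Generation. A transitive bisection \<open>(B, \<beta>\<^sub>Z(B))\<close> splits the Lie algebra generated by the bracketings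
of \<open>Y\<close> into a sum of the Lie algebras generated by those of \<open>B\<close> and of \<open>\<beta>\<^sub>Z(B)\<close>; this is Lazard
elimination (\<open>lie_hull_elimination\<close>, \<open>lie_hull_bisection\<close>). It applies because bracketing once more
with an element of \<open>B\<close> leads from one iterated bracket \<open>[..[z,v\<^sub>1],..,v\<^sub>k]\<close> to the next, and such a
bracket vanishes unless \<open>z\<close> is the only initial letter of \<open>z v\<^sub>1..v\<^sub>k\<close>. By induction the free
partially commutative Lie algebra is a sum of Lie algebras, one for each component of a finite transitive
factorization (\<open>lie_hull_letters_subset\<close>). In a local model of a complete factorization, a component
has at most one generator among the traces that survive the truncation, and a Lie algebra with one
generator is the module spanned by it; so a truncated element is a linear combination of the
\<open>\<Pi>(l\<^sub>i)\<close> (\<open>free_pc_lie_subset_span_bracketing\<close>).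

Independence. The span of the \<open>\<Pi>(l\<^sub>i)\<close> is now known to be a Lie algebra that contains the letters, so
the straightening argument of the Poincare-Birkhoff-Witt theorem writes every trace as a combination
of products \<open>\<Pi>(l\<^sub>i\<^sub>1)..\<Pi>(l\<^sub>i\<^sub>n)\<close> with \<open>i\<^sub>1 \<le> .. \<le> i\<^sub>n\<close> (\<open>trace_in_span_sorted_products\<close>). The factorization is
complete, so the traces \<open>l\<^sub>i\<^sub>1..l\<^sub>i\<^sub>n\<close> that belong to these products are pairwise different
(\<open>sorted_product_inj\<close>). Among finitely many traces there are thus at most as many products
as traces, and a spanning family of a finite free module that is no larger than its rank is
independent, over any commutative ring (\<open>square_spanning_family_independent\<close>). The \<open>\<Pi>(l\<^sub>i)\<close> are
the products of length one.
\<close>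


section \<open>Finitely supported functions\<close>

lemma lookup_pm_scale [simp]:
  "Poly_Mapping.lookup (pm_scale c p) m = c * Poly_Mapping.lookup p m"
  by (simp add: pm_scale_def Poly_Mapping.map.rep_eq when_def)

lemma pm_scale_single [simp]: "pm_scale c (Poly_Mapping.single m a) = Poly_Mapping.single m (c * a)"
  by (rule poly_mapping_eqI) (simp add: lookup_single when_def)

lemma keys_pm_scale: "Poly_Mapping.keys (pm_scale c p) \<subseteq> Poly_Mapping.keys p"
  by (auto simp: in_keys_iff)

lemma poly_mapping_eq_sum_single:
  fixes p :: "'m \<Rightarrow>\<^sub>0 'k::comm_ring_1"
  assumes "finite F" "Poly_Mapping.keys p \<subseteq> F"
  shows "p = (\<Sum>s\<in>F. Poly_Mapping.single s (Poly_Mapping.lookup p s))"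
proof (rule poly_mapping_eqI)
  fix m
  have "(\<Sum>s\<in>F. Poly_Mapping.lookup (Poly_Mapping.single s (Poly_Mapping.lookup p s)) m)
      = (\<Sum>s\<in>F. if m = s then Poly_Mapping.lookup p m else 0)"
    by (intro sum.cong) (auto simp: lookup_single when_def)
  also have "\<dots> = Poly_Mapping.lookup p m"
    using assms by (auto simp: sum.delta' in_keys_iff)
  finally show "Poly_Mapping.lookup p m
      = Poly_Mapping.lookup (\<Sum>s\<in>F. Poly_Mapping.single s (Poly_Mapping.lookup p s)) m"
    by (simp add: lookup_sum)
qed

lemma poly_mapping_linear_induct [case_names zero single add]:
  fixes p :: "'m \<Rightarrow>\<^sub>0 'k::comm_ring_1"
  assumes "Q 0" "\<And>s a. Q (Poly_Mapping.single s a)" "\<And>p q. Q p \<Longrightarrow> Q q \<Longrightarrow> Q (p + q)"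
  shows "Q p"
proof -
  have *: "Q (\<Sum>s\<in>F. Poly_Mapping.single s (Poly_Mapping.lookup p s))" if "finite F" for F
    using that by induction (auto intro: assms)
  show ?thesis
    by (subst poly_mapping_eq_sum_single[OF finite_keys order_refl]) (rule *[OF finite_keys])
qed

definition restrict_keys :: "'m set \<Rightarrow> ('m \<Rightarrow>\<^sub>0 'k::comm_ring_1) \<Rightarrow> ('m \<Rightarrow>\<^sub>0 'k)" where
  "restrict_keys T p = (\<Sum>s\<in>Poly_Mapping.keys p \<inter> T. Poly_Mapping.single s (Poly_Mapping.lookup p s))"

lemma lookup_restrict_keys: "Poly_Mapping.lookup (restrict_keys T p) m = (if m \<in> T then Poly_Mapping.lookup p m else 0)"
proof -
  have "Poly_Mapping.lookup (restrict_keys T p) m =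
      (\<Sum>s\<in>Poly_Mapping.keys p \<inter> T. if s = m then Poly_Mapping.lookup p m else 0)"
    unfolding restrict_keys_def lookup_sum by (intro sum.cong) (auto simp: lookup_single when_def)
  then show ?thesis by (auto simp: in_keys_iff)
qed

lemma restrict_keys_add: "restrict_keys T (p + q) = restrict_keys T p + restrict_keys T q"
  and restrict_keys_diff: "restrict_keys T (p - q) = restrict_keys T p - restrict_keys T q"
  and restrict_keys_scale: "restrict_keys T (pm_scale c p) = pm_scale c (restrict_keys T p)"
  and restrict_keys_zero [simp]: "restrict_keys T 0 = 0"
  by (rule poly_mapping_eqI, simp add: lookup_restrict_keys lookup_add lookup_minus)+

lemma restrict_keys_id: "Poly_Mapping.keys p \<subseteq> T \<Longrightarrow> restrict_keys T p = p"
  by (rule poly_mapping_eqI) (auto simp: lookup_restrict_keys in_keys_iff)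

lemma restrict_keys_disjoint: "Poly_Mapping.keys p \<inter> T = {} \<Longrightarrow> restrict_keys T p = 0"
  by (simp add: restrict_keys_def)

lemma keys_restrict_keys: "Poly_Mapping.keys (restrict_keys T p) = Poly_Mapping.keys p \<inter> T"
  by (auto simp: in_keys_iff lookup_restrict_keys split: if_splits)

lemma subspace_restrict_keys_preimage:
  assumes "pm.subspace W" shows "pm.subspace {p. restrict_keys T p \<in> W}"
  using assms by (auto simp: pm.subspace_def restrict_keys_add restrict_keys_scale)

section \<open>Lie algebras in the algebra of a semigroup\<close>

text \<open>
Enlarging the index sets beyond the supports makes bilinearity a matter of comparing sums over the same
set.
\<close>

lemma alg_mult_eq_sum:
  fixes p q :: "'m \<Rightarrow>\<^sub>0 'k::comm_ring_1"
  assumes "finite F" "Poly_Mapping.keys p \<subseteq> F" "finite H" "Poly_Mapping.keys q \<subseteq> H"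
  shows "alg_mult G p q = (\<Sum>s\<in>F. \<Sum>t\<in>H. Poly_Mapping.single (s \<otimes>\<^bsub>G\<^esub> t)
    (Poly_Mapping.lookup p s * Poly_Mapping.lookup q t))"
proof -
  have "alg_mult G p q = (\<Sum>s\<in>Poly_Mapping.keys p. \<Sum>t\<in>H. Poly_Mapping.single (s \<otimes>\<^bsub>G\<^esub> t)
    (Poly_Mapping.lookup p s * Poly_Mapping.lookup q t))"
    unfolding alg_mult_def
    by (intro sum.cong HOL.refl sum.mono_neutral_left) (use assms in \<open>auto simp: in_keys_iff\<close>)
  also have "\<dots> = (\<Sum>s\<in>F. \<Sum>t\<in>H. Poly_Mapping.single (s \<otimes>\<^bsub>G\<^esub> t)
    (Poly_Mapping.lookup p s * Poly_Mapping.lookup q t))"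
    by (intro sum.mono_neutral_left) (use assms in \<open>auto simp: in_keys_iff\<close>)
  finally show ?thesis .
qed

lemma alg_mult_single:
  "alg_mult G (Poly_Mapping.single s a) (Poly_Mapping.single t b)
    = Poly_Mapping.single (s \<otimes>\<^bsub>G\<^esub> t) (a * b)"
  by (subst alg_mult_eq_sum[of "{s}" _ "{t}"]) auto

lemma alg_mult_add_left: "alg_mult G (p + p') q = alg_mult G p q + alg_mult G p' q"
proof -
  let ?F = "Poly_Mapping.keys p \<union> Poly_Mapping.keys p'" and ?H = "Poly_Mapping.keys q"
  have "Poly_Mapping.keys (p + p') \<subseteq> ?F" by (rule Poly_Mapping.keys_add)
  then show ?thesis
    by (simp add: alg_mult_eq_sum[of ?F _ ?H] lookup_add distrib_right single_add sum.distrib)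
qed

lemma alg_mult_add_right: "alg_mult G p (q + q') = alg_mult G p q + alg_mult G p q'"
proof -
  let ?F = "Poly_Mapping.keys q \<union> Poly_Mapping.keys q'" and ?H = "Poly_Mapping.keys p"
  have "Poly_Mapping.keys (q + q') \<subseteq> ?F" by (rule Poly_Mapping.keys_add)
  then show ?thesis
    by (simp add: alg_mult_eq_sum[of ?H _ ?F] lookup_add distrib_left single_add sum.distrib)
qed

lemma alg_mult_zero_left [simp]: "alg_mult G 0 q = 0"
  and alg_mult_zero_right [simp]: "alg_mult G p 0 = 0"
  by (simp_all add: alg_mult_def)

lemma alg_mult_minus_left: "alg_mult G (- p) q = - alg_mult G p q"
  by (metis add_eq_0_iff alg_mult_add_left alg_mult_zero_left right_minus)

lemma alg_mult_minus_right: "alg_mult G p (- q) = - alg_mult G p q"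
  by (metis add_eq_0_iff alg_mult_add_right alg_mult_zero_right right_minus)

lemma alg_mult_diff_left: "alg_mult G (p - p') q = alg_mult G p q - alg_mult G p' q"
  using alg_mult_add_left[of G p "- p'" q] by (simp add: alg_mult_minus_left)

lemma alg_mult_diff_right: "alg_mult G p (q - q') = alg_mult G p q - alg_mult G p q'"
  using alg_mult_add_right[of G p q "- q'"] by (simp add: alg_mult_minus_right)

lemma alg_mult_scale_left: "alg_mult G (pm_scale c p) q = pm_scale c (alg_mult G p q)"
  by (subst (1 2) alg_mult_eq_sum[of "Poly_Mapping.keys p" _ "Poly_Mapping.keys q"])
    (simp_all add: keys_pm_scale pm.scale_sum_right mult.assoc)

lemma alg_mult_scale_right: "alg_mult G p (pm_scale c q) = pm_scale c (alg_mult G p q)"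
  by (subst (1 2) alg_mult_eq_sum[of "Poly_Mapping.keys p" _ "Poly_Mapping.keys q"])
    (simp_all add: keys_pm_scale pm.scale_sum_right mult_ac)

lemma keys_alg_mult:
  "Poly_Mapping.keys (alg_mult G p q) \<subseteq>
    (\<lambda>(s, t). s \<otimes>\<^bsub>G\<^esub> t) ` (Poly_Mapping.keys p \<times> Poly_Mapping.keys q)"
proof -
  have eq: "alg_mult G p q = (\<Sum>x\<in>Poly_Mapping.keys p \<times> Poly_Mapping.keys q.
      Poly_Mapping.single (case x of (s, t) \<Rightarrow> s \<otimes>\<^bsub>G\<^esub> t)
       (case x of (s, t) \<Rightarrow> Poly_Mapping.lookup p s * Poly_Mapping.lookup q t))"
    by (auto simp: alg_mult_def sum.cartesian_product intro!: sum.cong)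
  have "Poly_Mapping.keys (alg_mult G p q) \<subseteq> (\<Union>x\<in>Poly_Mapping.keys p \<times> Poly_Mapping.keys q.
      Poly_Mapping.keys (Poly_Mapping.single (case x of (s, t) \<Rightarrow> s \<otimes>\<^bsub>G\<^esub> t)
       (case x of (s, t) \<Rightarrow> Poly_Mapping.lookup p s * Poly_Mapping.lookup q t)))"
    unfolding eq by (rule Poly_Mapping.keys_sum)
  then show ?thesis by (fastforce split: if_splits)
qed

lemma alg_mult_commute:
  assumes "\<And>s t. s \<in> Poly_Mapping.keys p \<Longrightarrow> t \<in> Poly_Mapping.keys q \<Longrightarrow> s \<otimes>\<^bsub>G\<^esub> t = t \<otimes>\<^bsub>G\<^esub> s"
  shows "alg_mult G p q = alg_mult G q p"
proof -
  have "alg_mult G p q = (\<Sum>s\<in>Poly_Mapping.keys p. \<Sum>t\<in>Poly_Mapping.keys q.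
     Poly_Mapping.single (t \<otimes>\<^bsub>G\<^esub> s) (Poly_Mapping.lookup q t * Poly_Mapping.lookup p s))"
    unfolding alg_mult_def by (intro sum.cong[OF HOL.refl], metis assms mult.commute)
  then show ?thesis
    unfolding alg_mult_def by (subst sum.swap)
qed

text \<open>
Unlike \<open>lie_subalgebra\<close>, this does not confine the supports to the carrier, so that its hull is a Lie
algebra for every set of generators.
\<close>

definition lie_closed :: "('m, 'r) monoid_scheme \<Rightarrow> ('m \<Rightarrow>\<^sub>0 'k::comm_ring_1) set \<Rightarrow> bool" where
  "lie_closed G S \<longleftrightarrow> pm.subspace S \<and> (\<forall>p\<in>S. \<forall>q\<in>S. lie_bracket G p q \<in> S)"

lemma lie_closedI:
  assumes "0 \<in> S" "\<And>p q. p \<in> S \<Longrightarrow> q \<in> S \<Longrightarrow> p + q \<in> S" "\<And>c p. p \<in> S \<Longrightarrow> pm_scale c p \<in> S"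
    "\<And>p q. p \<in> S \<Longrightarrow> q \<in> S \<Longrightarrow> lie_bracket G p q \<in> S"
  shows "lie_closed G S"
  using assms by (simp add: lie_closed_def pm.subspace_def)

lemma lie_closed_hull: "lie_closed G (lie_closed G hull S)"
  by (rule hull_in) (auto simp: lie_closed_def intro: pm.subspace_Inter)

lemma subspace_lie_hull: "pm.subspace (lie_closed G hull S)"
  using lie_closed_hull[of G S] by (simp add: lie_closed_def)

lemma bracket_lie_hull:
  "p \<in> lie_closed G hull S \<Longrightarrow> q \<in> lie_closed G hull S \<Longrightarrow> lie_bracket G p q \<in> lie_closed G hull S"
  using lie_closed_hull[of G S] by (simp add: lie_closed_def)

lemma lie_bracket_add_left: "lie_bracket G (p + p') q = lie_bracket G p q + lie_bracket G p' q"
  and lie_bracket_add_right: "lie_bracket G p (q + q') = lie_bracket G p q + lie_bracket G p q'"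
  by (simp_all add: lie_bracket_def alg_mult_add_left alg_mult_add_right)

lemma lie_bracket_scale_left: "lie_bracket G (pm_scale c p) q = pm_scale c (lie_bracket G p q)"
  and lie_bracket_scale_right: "lie_bracket G p (pm_scale c q) = pm_scale c (lie_bracket G p q)"
  by (simp_all add: lie_bracket_def alg_mult_scale_left alg_mult_scale_right
      pm.scale_right_diff_distrib)

lemma lie_bracket_zero [simp]: "lie_bracket G 0 q = 0" "lie_bracket G p 0 = 0"
  by (simp_all add: lie_bracket_def)

lemma lie_bracket_self [simp]: "lie_bracket G p p = 0"
  by (simp add: lie_bracket_def)

lemma lie_bracket_antisym: "lie_bracket G p q = - lie_bracket G q p"
  by (simp add: lie_bracket_def)

text \<open>
Associativity is demanded of all elements of the type. The product of traces satisfies this, and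
the algebra laws then hold without conditions on supports. A unit is not available at this level.
\<close>

locale semigroup_algebra =
  fixes G :: "('m, 'r) monoid_scheme"
  assumes mult_assoc: "(s \<otimes>\<^bsub>G\<^esub> t) \<otimes>\<^bsub>G\<^esub> u = s \<otimes>\<^bsub>G\<^esub> (t \<otimes>\<^bsub>G\<^esub> u)"
begin

lemma alg_mult_assoc:
  fixes p q r :: "'m \<Rightarrow>\<^sub>0 'k::comm_ring_1"
  shows "alg_mult G (alg_mult G p q) r = alg_mult G p (alg_mult G q r)"
proof (induction p rule: poly_mapping_linear_induct)
  case (single s a)
  show ?case
  proof (induction q rule: poly_mapping_linear_induct)
    case (single t b)
    show ?case
      by (induction r rule: poly_mapping_linear_induct)
        (simp_all add: alg_mult_single alg_mult_add_right mult_assoc mult.assoc)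
  qed (simp_all add: alg_mult_add_left alg_mult_add_right)
qed (simp_all add: alg_mult_add_left)

lemma jacobi_right:
  "lie_bracket G p (lie_bracket G q r)
    = lie_bracket G (lie_bracket G p q) r - lie_bracket G (lie_bracket G p r) q"
  by (simp add: lie_bracket_def alg_mult_diff_left alg_mult_diff_right alg_mult_assoc)

lemma lie_bracket_derivation:
  "lie_bracket G (lie_bracket G p q) r
    = lie_bracket G (lie_bracket G p r) q + lie_bracket G p (lie_bracket G q r)"
  by (simp add: jacobi_right)

text \<open>
The linear half of Lazard elimination. If bracketing with the generators in \<open>E\<close> keeps \<open>X\<close> inside the Lie
algebra \<open>X*\<close> generated by \<open>X\<close>, then, right multiplication being a derivation, it keeps all of \<open>X*\<close>
inside \<open>X*\<close>. By the Jacobi identity, the elements acting on \<open>X*\<close> in this way form a Lie algebra, so the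
whole Lie algebra generated by \<open>E\<close> acts on \<open>X*\<close>. The sum of the two is then closed under the bracket.
\<close>

lemma lie_hull_elimination:
  assumes ad: "\<And>x e. x \<in> X \<Longrightarrow> e \<in> E \<Longrightarrow> lie_bracket G x e \<in> lie_closed G hull X"
  shows "lie_closed G hull (E \<union> X) \<subseteq> pm.span (lie_closed G hull E \<union> lie_closed G hull X)"
proof -
  let ?E = "lie_closed G hull E" and ?X = "lie_closed G hull X"
  note sub = pm.subspace_0 pm.subspace_add pm.subspace_scale pm.subspace_diff
  have 1: "lie_bracket G x e \<in> ?X" if "x \<in> ?X" "e \<in> E" for x e
  proof -
    have "lie_bracket G (lie_bracket G p q) e \<in> ?X"
      if "p \<in> ?X" "q \<in> ?X" "lie_bracket G p e \<in> ?X" "lie_bracket G q e \<in> ?X" for p q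
      unfolding lie_bracket_derivation[of p q e]
      using that by (auto intro!: pm.subspace_add[OF subspace_lie_hull] intro: bracket_lie_hull)
    then have "lie_closed G {x \<in> ?X. lie_bracket G x e \<in> ?X}"
      by (intro lie_closedI) (auto simp: lie_bracket_add_left lie_bracket_scale_left
          intro: sub subspace_lie_hull bracket_lie_hull)
    moreover have "X \<subseteq> {x \<in> ?X. lie_bracket G x e \<in> ?X}"
      using ad that by (auto intro: hull_inc)
    ultimately have "?X \<subseteq> {x \<in> ?X. lie_bracket G x e \<in> ?X}" by (intro hull_minimal)
    then show ?thesis using that by blast
  qed
  have 2: "lie_bracket G x e \<in> ?X" if "x \<in> ?X" "e \<in> ?E" for x e
  proof -
    have "lie_closed G {e. \<forall>x\<in>?X. lie_bracket G x e \<in> ?X}"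
      by (intro lie_closedI) (auto simp: lie_bracket_add_right lie_bracket_scale_right jacobi_right
          intro: sub subspace_lie_hull)
    moreover have "E \<subseteq> {e. \<forall>x\<in>?X. lie_bracket G x e \<in> ?X}" using 1 by blast
    ultimately have "?E \<subseteq> {e. \<forall>x\<in>?X. lie_bracket G x e \<in> ?X}" by (intro hull_minimal)
    then show ?thesis using that by blast
  qed
  have 3: "lie_bracket G e x \<in> ?X" if "x \<in> ?X" "e \<in> ?E" for x e
    unfolding lie_bracket_antisym[of G e x] by (intro pm.subspace_neg subspace_lie_hull 2 that)
  let ?W = "{e + x | e x. e \<in> ?E \<and> x \<in> ?X}"
  have W: "pm.span (?E \<union> ?X) = ?W"
    by (simp only: pm.span_Un pm.span_eq_iff[THEN iffD2, OF subspace_lie_hull])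
  have "lie_closed G ?W"
  proof (rule lie_closed_def[THEN iffD2], safe)
    show "pm.subspace ?W" unfolding W[symmetric] by (rule pm.subspace_span)
    fix e x e' x' assume *: "e \<in> ?E" "x \<in> ?X" "e' \<in> ?E" "x' \<in> ?X"
    have "lie_bracket G (e + x) (e' + x') = lie_bracket G e e'
        + (lie_bracket G e x' + (lie_bracket G x e' + lie_bracket G x x'))"
      by (simp add: lie_bracket_add_left lie_bracket_add_right add_ac)
    moreover have "lie_bracket G e x' + (lie_bracket G x e' + lie_bracket G x x') \<in> ?X"
      using * 2 3 bracket_lie_hull by (intro pm.subspace_add[OF subspace_lie_hull]) blast+
    ultimately show "\<exists>e'' x''. lie_bracket G (e + x) (e' + x') = e'' + x'' \<and> e'' \<in> ?E \<and> x'' \<in> ?X"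
      using * bracket_lie_hull by blast
  qed
  moreover have "E \<union> X \<subseteq> pm.span (?E \<union> ?X)"
    by (auto intro: pm.span_base hull_inc)
  ultimately show ?thesis unfolding W by (intro hull_minimal)
qed

text \<open>
The final factor \<open>u\<close> stands in for the missing unit; in the algebra of traces it will be the
empty trace.
\<close>

definition ordered_product :: "('i \<Rightarrow> 'm \<Rightarrow>\<^sub>0 'k::comm_ring_1) \<Rightarrow> 'i list \<Rightarrow> ('m \<Rightarrow>\<^sub>0 'k) \<Rightarrow> ('m \<Rightarrow>\<^sub>0 'k)" where
  "ordered_product g is u = foldr (\<lambda>i p. alg_mult G (g i) p) is u"

lemma ordered_product_simps [simp]:
  "ordered_product g [] u = u"
  "ordered_product g (i # is) u = alg_mult G (g i) (ordered_product g is u)"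
  "ordered_product g (is @ js) u = ordered_product g is (ordered_product g js u)"
  by (simp_all add: ordered_product_def)

lemma ordered_product_add: "ordered_product g is (u + v) = ordered_product g is u + ordered_product g is v"
  by (induction "is") (simp_all add: alg_mult_add_right)

lemma ordered_product_diff: "ordered_product g is (u - v) = ordered_product g is u - ordered_product g is v"
  by (induction "is") (simp_all add: alg_mult_diff_right)

lemma ordered_product_scale: "ordered_product g is (pm_scale c u) = pm_scale c (ordered_product g is u)"
  by (induction "is") (simp_all add: alg_mult_scale_right)

lemma ordered_product_zero [simp]: "ordered_product g is 0 = 0"
  by (induction "is") simp_all

text \<open>
The straightening step of the Poincare-Birkhoff-Witt theorem. Exchanging two neighbours changes a product
by the same product with the bracket of the two in their place; that bracket is linear in the \<open>g i\<close>, so the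
error consists of shorter products, which are treated by induction. Insertion sort is a sequence of such
exchanges.
\<close>

lemma ordered_product_in_span_sorted:
  fixes g :: "'i::linorder \<Rightarrow> 'm \<Rightarrow>\<^sub>0 'k::comm_ring_1"
  assumes br: "\<And>i j. i \<in> I \<Longrightarrow> j \<in> I \<Longrightarrow> lie_bracket G (g i) (g j) \<in> pm.span (g ` I)"
    and "is \<in> lists I"
  shows "ordered_product g is u \<in> pm.span ((\<lambda>js. ordered_product g js u) ` {js \<in> lists I. sorted js})"
    (is "_ \<in> ?S")
  using assms(2)
proof (induction "length is" arbitrary: "is" rule: less_induct)
  case less
  have drop: "ordered_product g xs (alg_mult G q (ordered_product g ys u)) \<in> ?S"
    if "q \<in> pm.span (g ` I)" "xs \<in> lists I" "ys \<in> lists I" "length xs + length ys + 1 < length is" for q xs ys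
    using that(1)
  proof (induction q rule: pm.span_induct_alt)
    case base
    show ?case by (simp add: pm.span_zero)
  next
    case (step c x y)
    then obtain k where k: "k \<in> I" "x = g k" by blast
    have "ordered_product g (xs @ k # ys) u \<in> ?S"
      by (rule less.hyps) (use that k in auto)
    then show ?case
      using step k by (simp add: alg_mult_add_left alg_mult_scale_left ordered_product_add
          ordered_product_scale pm.span_add pm.span_scale)
  qed
  have swap: "ordered_product g (xs @ i # j # ys) u - ordered_product g (xs @ j # i # ys) u \<in> ?S"
    if "xs \<in> lists I" "i \<in> I" "j \<in> I" "ys \<in> lists I" "length xs + length ys + 2 = length is" for xs i j ys
  proof -
    have "ordered_product g (xs @ i # j # ys) u - ordered_product g (xs @ j # i # ys) u
      = ordered_product g xs (alg_mult G (lie_bracket G (g i) (g j)) (ordered_product g ys u))"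
      by (simp add: lie_bracket_def alg_mult_diff_left alg_mult_assoc ordered_product_diff)
    then show ?thesis using drop[OF br] that by auto
  qed
  have insort: "ordered_product g (xs @ i # ys) u - ordered_product g (xs @ insort i ys) u \<in> ?S"
    if "xs \<in> lists I" "i \<in> I" "ys \<in> lists I" "length xs + length ys + 1 = length is" for xs i ys
    using that
  proof (induction ys arbitrary: xs)
    case Nil
    then show ?case by (simp add: pm.span_zero)
  next
    case (Cons j ys)
    show ?case
    proof (cases "i \<le> j")
      case True
      then show ?thesis by (simp add: pm.span_zero)
    next
      case False
      have 1: "ordered_product g (xs @ i # j # ys) u - ordered_product g (xs @ j # i # ys) u \<in> ?S"
        by (rule swap) (use Cons.prems in auto)
      have 2: "ordered_product g ((xs @ [j]) @ i # ys) u - ordered_product g ((xs @ [j]) @ insort i ys) u \<in> ?S"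
        by (rule Cons.IH) (use Cons.prems in auto)
      show ?thesis
        using pm.span_add[OF 1 2] False by simp
    qed
  qed
  have sort: "ordered_product g (xs @ ys) u - ordered_product g (xs @ sort ys) u \<in> ?S"
    if "xs \<in> lists I" "ys \<in> lists I" "length xs + length ys = length is" for xs ys
    using that
  proof (induction ys arbitrary: xs)
    case Nil
    then show ?case by (simp add: pm.span_zero)
  next
    case (Cons j ys)
    have 1: "ordered_product g ((xs @ [j]) @ ys) u - ordered_product g ((xs @ [j]) @ sort ys) u \<in> ?S"
      by (rule Cons.IH) (use Cons.prems in auto)
    have 2: "ordered_product g (xs @ j # sort ys) u - ordered_product g (xs @ insort j (sort ys)) u \<in> ?S"
      by (rule insort) (use Cons.prems in auto)
    show ?case using pm.span_add[OF 1 2] by simp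
  qed
  have "ordered_product g (sort is) u \<in> ?S"
    using less.prems by (intro pm.span_base) auto
  with sort[of "[]" "is"] less.prems show ?case
    using pm.span_add by fastforce
qed

end

section \<open>Square spanning families over a commutative ring\<close>

text \<open>
Over a commutative ring there is no dimension count, but \<open>V C = 1\<close> makes \<open>det V\<close> a unit, and the
adjugate matrix then expresses \<open>C\<close> as the two-sided inverse of \<open>V\<close>.
\<close>

lemma right_inverse_mat_is_left_inverse:
  fixes V C :: "'k::comm_ring_1 mat"
  assumes V: "V \<in> carrier_mat n n" and C: "C \<in> carrier_mat n n" and VC: "V * C = 1\<^sub>m n"
  shows "C * V = 1\<^sub>m n"
proof -
  have adj: "adj_mat V \<in> carrier_mat n n" "adj_mat V * V = det V \<cdot>\<^sub>m 1\<^sub>m n" using adj_mat[OF V] by auto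
  have dets: "det C * det V = 1"
    using det_mult[OF V C] unfolding VC by (simp add: mult.commute)
  have "det V \<cdot>\<^sub>m C = (adj_mat V * V) * C"
    using C by (simp add: adj(2) mult_smult_assoc_mat[OF one_carrier_mat C])
  also have "\<dots> = adj_mat V"
    using adj(1) V C by (simp add: assoc_mult_mat[OF adj(1) V C] VC)
  finally have detC: "det V \<cdot>\<^sub>m C = adj_mat V" .
  have smult: "k \<cdot>\<^sub>m (l \<cdot>\<^sub>m X) = (k * l) \<cdot>\<^sub>m X" for k l and X :: "'k mat"
    by (rule eq_matI) (simp_all add: mult.assoc)
  have "C * V = (det C * det V) \<cdot>\<^sub>m (C * V)"
    unfolding dets by (rule eq_matI) simp_all
  also have "\<dots> = det C \<cdot>\<^sub>m ((det V \<cdot>\<^sub>m C) * V)"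
    by (simp add: smult mult_smult_assoc_mat[OF C V])
  also have "\<dots> = (det C * det V) \<cdot>\<^sub>m 1\<^sub>m n" by (simp add: detC adj(2) smult)
  also have "\<dots> = 1\<^sub>m n" unfolding dets by (rule eq_matI) simp_all
  finally show ?thesis .
qed

lemma span_image_finite:
  assumes "finite T" "p \<in> pm.span (v ` T)"
  shows "\<exists>c. p = (\<Sum>t\<in>T. pm_scale (c t) (v t))"
  using assms(2)
proof (induction p rule: pm.span_induct_alt)
  case base
  show ?case by (intro exI[of _ "\<lambda>_. 0"]) simp
next
  case (step a x y)
  then obtain c s where c: "y = (\<Sum>t\<in>T. pm_scale (c t) (v t))" and s: "s \<in> T" "x = v s" by blast
  have "(\<Sum>t\<in>T. pm_scale ((if t = s then a else 0) + c t) (v t)) =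
      (\<Sum>t\<in>T. (if t = s then pm_scale a (v t) else 0)) + y"
    unfolding c sum.distrib[symmetric] by (intro sum.cong) (auto simp: pm.scale_left_distrib)
  then show ?case using s assms(1) by (intro exI[of _ "\<lambda>t. (if t = s then a else 0) + c t"]) simp
qed

text \<open>
Both the family and the standard basis that it generates are indexed by the finite set \<open>T\<close>. The coefficients that
express the basis form a right inverse of the square matrix of the family, hence also a left inverse.
\<close>

lemma square_spanning_family_independent:
  fixes v :: "'m \<Rightarrow> 'm \<Rightarrow>\<^sub>0 'k::comm_ring_1"
  assumes T: "finite T" and span: "\<And>t. t \<in> T \<Longrightarrow> Poly_Mapping.single t 1 \<in> pm.span (v ` T)"
    and x: "(\<Sum>t\<in>T. pm_scale (x t) (v t)) = 0" and "t \<in> T"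
  shows "x t = 0"
proof -
  obtain e where e: "bij_betw e {0..<card T} T" using ex_bij_betw_nat_finite[OF T] by blast
  let ?n = "card T"
  have "\<forall>t\<in>T. \<exists>c. Poly_Mapping.single t 1 = (\<Sum>s\<in>T. pm_scale (c s) (v s))"
    using span span_image_finite[OF T] by blast
  then obtain c where c: "\<And>t. t \<in> T \<Longrightarrow> Poly_Mapping.single t 1 = (\<Sum>s\<in>T. pm_scale (c t s) (v s))"
    by metis
  have eT: "e i \<in> T" if "i < ?n" for i using e that by (auto simp: bij_betw_def)
  have inj: "e i = e j \<longleftrightarrow> i = j" if "i < ?n" "j < ?n" for i j
    using e that by (auto simp: bij_betw_def inj_on_def)
  have sum_e: "(\<Sum>s\<in>T. h s) = (\<Sum>i = 0..<?n. h (e i))" for h :: "'m \<Rightarrow> 'k"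
    using sum.reindex_bij_betw[OF e, of h] by simp
  define V where "V = mat ?n ?n (\<lambda>(i, j). Poly_Mapping.lookup (v (e j)) (e i))"
  define C where "C = mat ?n ?n (\<lambda>(j, k). c (e k) (e j))"
  define X where "X = vec ?n (\<lambda>j. x (e j))"
  have dims: "V \<in> carrier_mat ?n ?n" "C \<in> carrier_mat ?n ?n" "X \<in> carrier_vec ?n"
    by (simp_all add: V_def C_def X_def)
  have "V * C = 1\<^sub>m ?n"
  proof (rule eq_matI)
    fix i k assume ik: "i < dim_row (1\<^sub>m ?n :: 'k mat)" "k < dim_col (1\<^sub>m ?n :: 'k mat)"
    then have ik': "i < ?n" "k < ?n" by auto
    have "(V * C) $$ (i, k) = (\<Sum>j = 0..<?n. c (e k) (e j) * Poly_Mapping.lookup (v (e j)) (e i))"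
      using ik' by (simp add: V_def C_def scalar_prod_def mult.commute)
    also have "\<dots> = Poly_Mapping.lookup (\<Sum>s\<in>T. pm_scale (c (e k) s) (v s)) (e i)"
      by (simp add: lookup_sum sum_e)
    also have "\<dots> = Poly_Mapping.lookup (Poly_Mapping.single (e k) 1) (e i)"
      using c[OF eT[OF ik'(2)]] by simp
    also have "\<dots> = 1\<^sub>m ?n $$ (i, k)" using ik' inj[of k i] by (auto simp: lookup_single when_def)
    finally show "(V * C) $$ (i, k) = 1\<^sub>m ?n $$ (i, k)" .
  qed (simp_all add: V_def C_def)
  then have CV: "C * V = 1\<^sub>m ?n" by (rule right_inverse_mat_is_left_inverse[OF dims(1,2)])
  have "V *\<^sub>v X = 0\<^sub>v ?n"
  proof (rule eq_vecI)
    fix i assume "i < dim_vec (0\<^sub>v ?n :: 'k vec)"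
    then have i: "i < ?n" by simp
    have "(V *\<^sub>v X) $ i = (\<Sum>j = 0..<?n. x (e j) * Poly_Mapping.lookup (v (e j)) (e i))"
      using i by (simp add: V_def X_def scalar_prod_def mult.commute)
    also have "\<dots> = Poly_Mapping.lookup (\<Sum>s\<in>T. pm_scale (x s) (v s)) (e i)"
      by (simp add: lookup_sum sum_e)
    also have "\<dots> = 0" by (simp add: x)
    finally show "(V *\<^sub>v X) $ i = 0\<^sub>v ?n $ i" using i by simp
  qed (simp add: V_def)
  moreover have "C *\<^sub>v 0\<^sub>v ?n = 0\<^sub>v ?n"
    using dims by (intro eq_vecI) (auto simp: scalar_prod_def)
  ultimately have "C *\<^sub>v (V *\<^sub>v X) = 0\<^sub>v ?n" by simp
  then have "X = 0\<^sub>v ?n"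
    using assoc_mult_mat_vec[OF dims(2,1,3)] dims by (simp add: CV)
  moreover obtain i where "i < ?n" "t = e i"
    using bij_betw_imp_surj_on[OF e] \<open>t \<in> T\<close> by (metis atLeastLessThan_iff imageE)
  ultimately show ?thesis by (metis X_def index_vec index_zero_vec(1))
qed

text \<open>
Independence of the family, as opposed to that of its set of values, already contains injectivity: for
\<open>b i = b j\<close> with \<open>i \<noteq> j\<close>, the difference would be a relation with coefficients \<open>1\<close> and \<open>-1\<close>.
\<close>

lemma family_basisI:
  assumes span: "pm.span (b ` I) = L"
    and ind: "\<And>J c i. finite J \<Longrightarrow> J \<subseteq> I \<Longrightarrow> (\<Sum>i\<in>J. pm_scale (c i) (b i)) = 0 \<Longrightarrow> i \<in> J \<Longrightarrow> c i = 0"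
  shows "family_basis I b L"
proof -
  have inj: "inj_on b I"
  proof (rule inj_onI, rule ccontr)
    fix i j assume ij: "i \<in> I" "j \<in> I" "b i = b j" "i \<noteq> j"
    have "(\<Sum>k\<in>{i, j}. pm_scale (if k = i then 1 else - 1) (b k)) = 0"
      using ij by simp
    then have "(if i = i then 1 else - 1 :: 'b) = 0" using ij by (intro ind[of "{i, j}"]) auto
    then show False by simp
  qed
  have "u v = 0" if t: "finite t" "t \<subseteq> b ` I" "(\<Sum>v\<in>t. pm_scale (u v) v) = 0" "v \<in> t" for t u v
  proof -
    obtain J where J: "J \<subseteq> I" "finite J" "t = b ` J" using t(1,2) by (meson finite_subset_image)
    have "(\<Sum>j\<in>J. pm_scale (u (b j)) (b j)) = 0"
      using t(3) unfolding J(3) sum.reindex[OF inj_on_subset[OF inj J(1)]] by (simp add: comp_def)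
    then show ?thesis using ind[of J "\<lambda>j. u (b j)"] J t(4) by auto
  qed
  then have "pm.independent (b ` I)" unfolding pm.independent_explicit_module by blast
  then show ?thesis using inj span by (simp add: family_basis_def)
qed


section \<open>Words and traces\<close>

lemma trace_eq_mset: "trace_eq \<theta> u v \<Longrightarrow> mset u = mset v"
  by (induction rule: trace_eq.induct) auto

lemma trace_eq_set: "trace_eq \<theta> u v \<Longrightarrow> set u = set v"
  using trace_eq_mset mset_eq_setD by blast

lemma trace_eq_mono: "trace_eq \<theta> u v \<Longrightarrow> \<theta> \<subseteq> \<theta>' \<Longrightarrow> trace_eq \<theta>' u v"
  by (induction rule: trace_eq.induct) (auto intro: trace_eq.intros)

lemma trace_eq_restrict:
  "trace_eq \<theta> u v \<Longrightarrow> set u \<subseteq> B \<Longrightarrow> trace_eq (\<theta> \<inter> B \<times> B) u v"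
proof (induction rule: trace_eq.induct)
  case (trans u v w)
  then show ?case using trace_eq_set by (metis trace_eq.trans)
next
  case (sym u v)
  then show ?case using trace_eq_set by (metis trace_eq.sym)
qed (auto intro: trace_eq.intros)

lemma trace_of_eq_iff: "trace_of \<theta> u = trace_of \<theta> v \<longleftrightarrow> trace_eq \<theta> u v"
  unfolding trace_of_def using trace_eq.refl trace_eq.sym trace_eq.trans by blast

lemma trace_of_restrict: "set u \<subseteq> B \<Longrightarrow> trace_of (\<theta> \<inter> B \<times> B) u = trace_of \<theta> u"
  unfolding trace_of_def using trace_eq_restrict trace_eq_mono by fastforce

lemma trace_eq_commute_words:
  assumes "set u \<times> set v \<subseteq> \<theta>"
  shows "trace_eq \<theta> (u @ v) (v @ u)"
proof -
  have letter: "trace_eq \<theta> (a # v) (v @ [a])" if "{a} \<times> set v \<subseteq> \<theta>" for a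
    using that
  proof (induction v)
    case Nil
    show ?case by (simp add: trace_eq.refl)
  next
    case (Cons b v)
    have "trace_eq \<theta> ([a, b] @ v) ([b, a] @ v)"
      using Cons.prems by (intro trace_eq.append[OF trace_eq.commute trace_eq.refl]) auto
    moreover have "trace_eq \<theta> ([b] @ (a # v)) ([b] @ (v @ [a]))"
      using Cons by (intro trace_eq.append[OF trace_eq.refl]) auto
    ultimately show ?case by (auto intro: trace_eq.trans)
  qed
  show ?thesis
    using assms
  proof (induction u)
    case Nil
    show ?case by (simp add: trace_eq.refl)
  next
    case (Cons a u)
    have "trace_eq \<theta> ([a] @ (u @ v)) ([a] @ (v @ u))"
      using Cons by (intro trace_eq.append[OF trace_eq.refl]) auto
    moreover have "trace_eq \<theta> ((a # v) @ u) ((v @ [a]) @ u)"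
      using Cons.prems by (intro trace_eq.append[OF letter trace_eq.refl]) auto
    ultimately show ?case by (auto intro: trace_eq.trans)
  qed
qed

text \<open>
A form of Levi's lemma. An occurrence of \<open>z\<close> that can be moved to the front of \<open>u\<close> stays movable under the
elementary commutations, and deleting it on both sides leaves equivalent words. The
property is stated for a relation \<open>F\<close> between words and proved in both directions at once, as the equivalence is
generated with a symmetry rule.
\<close>

lemma trace_eq_front:
  assumes "trace_eq \<theta> u w" "sym \<theta>" "u = p @ z # s" "set p \<times> {z} \<subseteq> \<theta>"
  obtains p' s' where "w = p' @ z # s'" "set p' \<times> {z} \<subseteq> \<theta>" "trace_eq \<theta> (p @ s) (p' @ s')"
proof -
  define F where "F = (\<lambda>u w. \<forall>p z s. u = p @ z # s \<longrightarrow> set p \<times> {z} \<subseteq> \<theta> \<longrightarrow>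
    (\<exists>p' s'. w = p' @ z # s' \<and> set p' \<times> {z} \<subseteq> \<theta> \<and> trace_eq \<theta> (p @ s) (p' @ s')))"
  have FI: "F u w" if "\<And>p z s. u = p @ z # s \<Longrightarrow> set p \<times> {z} \<subseteq> \<theta> \<Longrightarrow>
      \<exists>p' s'. w = p' @ z # s' \<and> set p' \<times> {z} \<subseteq> \<theta> \<and> trace_eq \<theta> (p @ s) (p' @ s')" for u w
    using that unfolding F_def by blast
  have FD: "\<exists>p' s'. w = p' @ z # s' \<and> set p' \<times> {z} \<subseteq> \<theta> \<and> trace_eq \<theta> (p @ s) (p' @ s')"
    if "F u w" "u = p @ z # s" "set p \<times> {z} \<subseteq> \<theta>" for u w p z s
    using that unfolding F_def by blast
  have F_trans: "F x z" if "F x y" "F y z" for x y z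
  proof (rule FI)
    fix p a s
    assume "x = p @ a # s" "set p \<times> {a} \<subseteq> \<theta>"
    from FD[OF \<open>F x y\<close> this] obtain p' s'
      where 1: "y = p' @ a # s'" "set p' \<times> {a} \<subseteq> \<theta>" "trace_eq \<theta> (p @ s) (p' @ s')" by blast
    from FD[OF \<open>F y z\<close> 1(1,2)] 1(3)
    show "\<exists>p' s'. z = p' @ a # s' \<and> set p' \<times> {a} \<subseteq> \<theta> \<and> trace_eq \<theta> (p @ s) (p' @ s')"
      using trace_eq.trans by blast
  qed
  have F_append: "F (x @ y) (x' @ y')"
    if "F x x'" "F y y'" and teq: "trace_eq \<theta> x x'" "trace_eq \<theta> y y'" for x x' y y'
  proof (rule FI)
    fix p a s
    assume eq: "x @ y = p @ a # s" and ind: "set p \<times> {a} \<subseteq> \<theta>"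
    from eq consider s1 where "x = p @ a # s1" "s = s1 @ y" | p2 where "p = x @ p2" "y = p2 @ a # s"
    proof -
      from eq obtain us where "x = p @ us \<and> us @ y = a # s \<or> x @ us = p \<and> y = us @ a # s"
        unfolding append_eq_append_conv2 by blast
      then show thesis using that by (cases us) auto
    qed
    then show "\<exists>p' s'. x' @ y' = p' @ a # s' \<and> set p' \<times> {a} \<subseteq> \<theta> \<and> trace_eq \<theta> (p @ s) (p' @ s')"
    proof cases
      case 1
      from FD[OF \<open>F x x'\<close> 1(1) ind] obtain p' s'
        where "x' = p' @ a # s'" "set p' \<times> {a} \<subseteq> \<theta>" "trace_eq \<theta> (p @ s1) (p' @ s')" by blast
      then show ?thesis
        using 1 trace_eq.append[of \<theta> "p @ s1" "p' @ s'" y y'] teq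
        by (intro exI[of _ p'] exI[of _ "s' @ y'"]) simp
    next
      case 2
      have "set p2 \<times> {a} \<subseteq> \<theta>" using 2 ind by auto
      from FD[OF \<open>F y y'\<close> 2(2) this] obtain p' s'
        where "y' = p' @ a # s'" "set p' \<times> {a} \<subseteq> \<theta>" "trace_eq \<theta> (p2 @ s) (p' @ s')" by blast
      then show ?thesis
        using 2 trace_eq.append[of \<theta> x x' "p2 @ s" "p' @ s'"] teq ind trace_eq_set[of \<theta> x x']
        by (intro exI[of _ "x' @ p'"] exI[of _ s']) auto
    qed
  qed
  have F_commute: "F [x, y] [y, x]" if xy: "(x, y) \<in> \<theta>" "(y, x) \<in> \<theta>" for x y
  proof (rule FI)
    fix p z s
    assume "[x, y] = p @ z # s"
    then consider "p = []" "z = x" "s = [y]" | "p = [x]" "z = y" "s = []"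
      by (auto simp: Cons_eq_append_conv)
    then show "\<exists>p' s'. [y, x] = p' @ z # s' \<and> set p' \<times> {z} \<subseteq> \<theta> \<and> trace_eq \<theta> (p @ s) (p' @ s')"
    proof cases
      case 1
      then show ?thesis using xy
        by (intro exI[of _ "[y]"] exI[of _ "[]"]) (simp add: trace_eq.refl)
    next
      case 2
      then show ?thesis
        by (intro exI[of _ "[]"] exI[of _ "[x]"]) (simp add: trace_eq.refl)
    qed
  qed
  from assms(1) have "F u w \<and> F w u"
  proof (induction rule: trace_eq.induct)
    case (refl u)
    have "F u u" by (rule FI) (use trace_eq.refl in blast)
    then show ?case by blast
  next
    case (append u u' v v')
    then show ?case using F_append trace_eq.sym by metis
  next
    case (commute a b)
    then have "(b, a) \<in> \<theta>" using assms(2) by (auto dest: symD)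
    then show ?case using F_commute commute by blast
  qed (use F_trans in blast)+
  then show thesis using FD assms(3,4) that by blast
qed

lemma trace_eq_Cons_cancel:
  assumes "trace_eq \<theta> (z # v) (z # v')" "sym \<theta>" "irrefl \<theta>"
  shows "trace_eq \<theta> v v'"
proof -
  obtain p s where ps: "z # v' = p @ z # s" "set p \<times> {z} \<subseteq> \<theta>" "trace_eq \<theta> v (p @ s)"
    using trace_eq_front[OF assms(1,2), of "[]" z v] by auto
  have "p = []"
  proof (cases p)
    case (Cons a q)
    then show ?thesis using ps assms(3) by (auto simp: irrefl_def)
  qed
  then show ?thesis using ps by auto
qed

text \<open>
If the word \<open>z v\<close> can also be written with another letter \<open>b\<close> in front, then \<open>b\<close> has
passed \<open>z\<close>. This is what makes the corresponding iterated bracket vanish.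
\<close>

lemma trace_eq_Cons_distinct:
  assumes "trace_eq \<theta> (z # v) (b # u)" "sym \<theta>" "z \<noteq> b"
  shows "(z, b) \<in> \<theta> \<and> (\<exists>v'. trace_eq \<theta> v (b # v'))"
proof -
  obtain p s where ps: "b # u = p @ z # s" "set p \<times> {z} \<subseteq> \<theta>" "trace_eq \<theta> v (p @ s)"
    using trace_eq_front[OF assms(1,2), of "[]" z v] by auto
  then obtain q where "p = b # q" using assms(3) by (cases p) auto
  then show ?thesis using ps assms(2) by (auto dest: symD)
qed

text \<open>
Equivalent words are permutations of each other, so the choice of representative does not matter.
\<close>

definition multidegree :: "'a trace \<Rightarrow> 'a multiset" where
  "multidegree t = mset (SOME u. u \<in> t)"

lemma multidegree_trace_of [simp]: "multidegree (trace_of \<theta> u) = mset u"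
proof -
  have "u \<in> trace_of \<theta> u" by (simp add: trace_of_def trace_eq.refl)
  then have "(SOME v. v \<in> trace_of \<theta> u) \<in> trace_of \<theta> u" by (rule someI)
  then show ?thesis by (simp add: multidegree_def trace_of_def trace_eq_mset)
qed

lemma Alph_trace_of [simp]: "Alph (trace_of \<theta> u) = set u"
  using trace_eq_set[of \<theta> u] by (auto simp: Alph_def trace_of_def intro: trace_eq.refl)

lemma carrier_trace_monoid: "carrier (trace_monoid A \<theta>) = trace_of \<theta> ` lists A"
  and one_trace_monoid: "\<one>\<^bsub>trace_monoid A \<theta>\<^esub> = trace_of \<theta> []"
  by (simp_all add: trace_monoid_def)

lemma mult_trace_monoid:
  "s \<otimes>\<^bsub>trace_monoid A \<theta>\<^esub> t = {w. \<exists>u\<in>s. \<exists>v\<in>t. trace_eq \<theta> (u @ v) w}"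
  by (auto simp: trace_monoid_def trace_of_def)

lemma mult_trace_of [simp]:
  "trace_of \<theta> u \<otimes>\<^bsub>trace_monoid A \<theta>\<^esub> trace_of \<theta> v = trace_of \<theta> (u @ v)"
  unfolding mult_trace_monoid trace_of_def
  by (auto intro: trace_eq.refl trace_eq.append trace_eq.trans)

text \<open>
Associativity holds for arbitrary sets of words, whether or not they are congruence classes, because the
product closes its value under the congruence.
\<close>

lemma trace_mult_assoc:
  "(s \<otimes>\<^bsub>trace_monoid A \<theta>\<^esub> t) \<otimes>\<^bsub>trace_monoid A \<theta>\<^esub> r
    = s \<otimes>\<^bsub>trace_monoid A \<theta>\<^esub> (t \<otimes>\<^bsub>trace_monoid A \<theta>\<^esub> r)"
proof -
  have cong: "trace_eq \<theta> (x @ y) w" if "trace_eq \<theta> (u @ v) w" "trace_eq \<theta> x u" "trace_eq \<theta> y v" for u v w x y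
    using that by (meson trace_eq.append trace_eq.trans)
  have "(s \<otimes>\<^bsub>trace_monoid A \<theta>\<^esub> t) \<otimes>\<^bsub>trace_monoid A \<theta>\<^esub> r
      = {w. \<exists>u\<in>s. \<exists>v\<in>t. \<exists>y\<in>r. trace_eq \<theta> ((u @ v) @ y) w}"
    unfolding mult_trace_monoid using cong trace_eq.refl by blast
  also have "\<dots> = s \<otimes>\<^bsub>trace_monoid A \<theta>\<^esub> (t \<otimes>\<^bsub>trace_monoid A \<theta>\<^esub> r)"
    unfolding mult_trace_monoid append_assoc using cong trace_eq.refl by blast
  finally show ?thesis .
qed

locale trace_algebra =
  fixes A :: "'a set" and \<theta> :: "('a \<times> 'a) set"
  assumes alphabet: "independence_alphabet A \<theta>"
begin

abbreviation M where "M \<equiv> trace_monoid A \<theta>"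

sublocale semigroup_algebra M
  by unfold_locales (rule trace_mult_assoc)

lemma sym_theta: "sym \<theta>" and irrefl_theta: "irrefl \<theta>"
  using alphabet by (auto simp: independence_alphabet_def)

lemma carrierE:
  assumes "t \<in> carrier M"
  obtains u where "u \<in> lists A" "t = trace_of \<theta> u"
  using assms by (auto simp: carrier_trace_monoid)

lemma trace_of_closed: "set u \<subseteq> A \<Longrightarrow> trace_of \<theta> u \<in> carrier M"
  unfolding carrier_trace_monoid by (intro imageI) auto

lemma mult_closed: "s \<in> carrier M \<Longrightarrow> t \<in> carrier M \<Longrightarrow> s \<otimes>\<^bsub>M\<^esub> t \<in> carrier M"
  by (auto elim!: carrierE intro!: trace_of_closed)

lemma multidegree_mult: "s \<in> carrier M \<Longrightarrow> t \<in> carrier M \<Longrightarrow> multidegree (s \<otimes>\<^bsub>M\<^esub> t) = multidegree s + multidegree t"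
  by (auto simp: carrier_trace_monoid)

lemma Alph_eq_multidegree: "t \<in> carrier M \<Longrightarrow> Alph t = set_mset (multidegree t)"
  by (auto simp: carrier_trace_monoid)

lemma multidegree_empty_iff: "t \<in> carrier M \<Longrightarrow> multidegree t = {#} \<longleftrightarrow> t = \<one>\<^bsub>M\<^esub>"
  by (auto simp: carrier_trace_monoid one_trace_monoid trace_of_eq_iff dest!: trace_eq_mset)

lemma mult_commute:
  assumes "s \<in> carrier M" "t \<in> carrier M" "set_mset (multidegree s) \<times> set_mset (multidegree t) \<subseteq> \<theta>"
  shows "s \<otimes>\<^bsub>M\<^esub> t = t \<otimes>\<^bsub>M\<^esub> s"
  using assms by (elim carrierE) (simp add: trace_of_eq_iff trace_eq_commute_words)

text \<open>
Whether a trace survives truncation depends on its multidegree only. The factors of a surviving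
product therefore survive, and a multihomogeneous element is kept or killed as a whole.
\<close>

lemma traces_upto_iff:
  assumes "t \<in> carrier M"
  shows "t \<in> traces_upto \<theta> B n \<longleftrightarrow> set_mset (multidegree t) \<subseteq> B \<and> size (multidegree t) \<le> n"
proof -
  obtain u where u: "u \<in> lists A" "t = trace_of \<theta> u" using assms by (rule carrierE)
  show ?thesis
  proof
    assume "t \<in> traces_upto \<theta> B n"
    then show "set_mset (multidegree t) \<subseteq> B \<and> size (multidegree t) \<le> n" by (auto simp: traces_upto_def)
  next
    assume "set_mset (multidegree t) \<subseteq> B \<and> size (multidegree t) \<le> n"
    then show "t \<in> traces_upto \<theta> B n"
      unfolding traces_upto_def u by (intro imageI) (auto simp: u)
  qed
qed

lemma traces_upto_subset: "B \<subseteq> A \<Longrightarrow> traces_upto \<theta> B n \<subseteq> carrier M"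
  by (auto simp: traces_upto_def carrier_trace_monoid)

lemma finite_traces_upto: "finite B \<Longrightarrow> finite (traces_upto \<theta> B n)"
  unfolding traces_upto_def using finite_lists_length_le[of B n] by (simp add: lists_eq_set)

lemma list_prod_simps [simp]:
  "list_prod M [] = \<one>\<^bsub>M\<^esub>" "list_prod M (x # xs) = x \<otimes>\<^bsub>M\<^esub> list_prod M xs"
  by (simp_all add: list_prod_def)

lemma one_closed [simp]: "\<one>\<^bsub>M\<^esub> \<in> carrier M"
  by (simp add: one_trace_monoid trace_of_closed)

lemma one_mult [simp]: "t \<in> carrier M \<Longrightarrow> \<one>\<^bsub>M\<^esub> \<otimes>\<^bsub>M\<^esub> t = t"
  and mult_one [simp]: "t \<in> carrier M \<Longrightarrow> t \<otimes>\<^bsub>M\<^esub> \<one>\<^bsub>M\<^esub> = t"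
  by (auto simp: carrier_trace_monoid one_trace_monoid)

lemma list_prod_closed: "set xs \<subseteq> carrier M \<Longrightarrow> list_prod M xs \<in> carrier M"
  by (induction xs) (auto simp: mult_closed)

lemma list_prod_append:
  "set xs \<subseteq> carrier M \<Longrightarrow> set ys \<subseteq> carrier M \<Longrightarrow> list_prod M (xs @ ys) = list_prod M xs \<otimes>\<^bsub>M\<^esub> list_prod M ys"
  by (induction xs) (auto simp: list_prod_closed mult_assoc)

lemma multidegree_list_prod:
  "set xs \<subseteq> carrier M \<Longrightarrow> multidegree (list_prod M xs) = (\<Sum>x\<leftarrow>xs. multidegree x)"
  by (induction xs) (auto simp: multidegree_mult list_prod_closed one_trace_monoid)

lemma gen_submonoid_closed: "X \<subseteq> carrier M \<Longrightarrow> gen_submonoid M X \<subseteq> carrier M"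
  by (auto simp: gen_submonoid_def intro!: list_prod_closed)

lemma gen_submonoid_base: "X \<subseteq> carrier M \<Longrightarrow> X \<subseteq> gen_submonoid M X"
proof
  fix x assume "X \<subseteq> carrier M" "x \<in> X"
  then show "x \<in> gen_submonoid M X"
    unfolding gen_submonoid_def by (intro image_eqI[of _ _ "[x]"]) auto
qed

lemma gen_submonoid_list_prod:
  "X \<subseteq> carrier M \<Longrightarrow> set xs \<subseteq> gen_submonoid M X \<Longrightarrow> list_prod M xs \<in> gen_submonoid M X"
proof (induction xs)
  case Nil
  have "[] \<in> lists X" by simp
  then show ?case unfolding gen_submonoid_def by (metis image_eqI list_prod_simps(1))
next
  case (Cons x xs)
  then obtain us vs where "us \<in> lists X" "x = list_prod M us" "vs \<in> lists X" "list_prod M xs = list_prod M vs"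
    by (auto simp: gen_submonoid_def)
  then show ?case
    using Cons.prems(1) unfolding gen_submonoid_def
    by (intro image_eqI[of _ _ "us @ vs"]) (auto simp: list_prod_append subset_iff)
qed

lemma gen_submonoid_mono:
  assumes "X \<subseteq> carrier M" "X' \<subseteq> gen_submonoid M X"
  shows "gen_submonoid M X' \<subseteq> gen_submonoid M X"
proof
  fix t assume "t \<in> gen_submonoid M X'"
  then obtain xs where "set xs \<subseteq> X'" "t = list_prod M xs" by (auto simp: gen_submonoid_def)
  then show "t \<in> gen_submonoid M X" using assms by (auto intro: gen_submonoid_list_prod)
qed


section \<open>Partially commutative codes\<close>

lemma sym_induced_indep: "sym (induced_indep \<theta> Y)"
  using sym_theta by (auto simp: induced_indep_def sym_def)

lemma list_prod_trace_eq:
  assumes "trace_eq (induced_indep \<theta> Y) xs ys" "Y \<subseteq> carrier M" "set xs \<subseteq> Y"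
  shows "list_prod M xs = list_prod M ys"
  using assms(1,3)
proof (induction rule: trace_eq.induct)
  case (sym u v)
  then show ?case using trace_eq_set by metis
next
  case (trans u v w)
  then show ?case using trace_eq_set by metis
next
  case (append u u' v v')
  then have "set u \<subseteq> Y" "set v \<subseteq> Y" "set u' \<subseteq> Y" "set v' \<subseteq> Y"
    using trace_eq_set[of _ u u'] trace_eq_set[of _ v v'] by auto
  then show ?case using append.IH assms(2) by (simp add: list_prod_append)
next
  case (commute x y)
  then have "x \<in> carrier M" "y \<in> carrier M" using assms(2) by auto
  moreover from this have "x \<otimes>\<^bsub>M\<^esub> y = y \<otimes>\<^bsub>M\<^esub> x"
    using commute by (intro mult_commute) (auto simp: induced_indep_def Alph_eq_multidegree)
  ultimately show ?case by simp
qed auto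

lemma trace_eval_trace_of:
  assumes "Y \<subseteq> carrier M" "set xs \<subseteq> Y"
  shows "trace_eval A \<theta> (trace_of (induced_indep \<theta> Y) xs) = list_prod M xs"
proof -
  have "list_prod M ` trace_of (induced_indep \<theta> Y) xs = {list_prod M xs}"
    using list_prod_trace_eq[OF _ assms] by (auto simp: trace_of_def intro: trace_eq.refl)
  then show ?thesis by (simp add: trace_eval_def)
qed

text \<open>
Injectivity of the canonical morphism, read on words: in this form of the code property the letters of
two factorizations over \<open>Y\<close> can be compared.
\<close>

lemma pc_code_iff:
  assumes "pc_code A \<theta> Y" "set xs \<subseteq> Y" "set ys \<subseteq> Y"
  shows "list_prod M xs = list_prod M ys \<longleftrightarrow> trace_eq (induced_indep \<theta> Y) xs ys"
proof
  have Y: "Y \<subseteq> carrier M" and inj: "inj_on (trace_eval A \<theta>) (trace_of (induced_indep \<theta> Y) ` lists Y)"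
    using assms(1) by (auto simp: pc_code_def iso_def bij_betw_def carrier_trace_monoid)
  show "trace_eq (induced_indep \<theta> Y) xs ys" if "list_prod M xs = list_prod M ys"
    using inj_onD[OF inj, of "trace_of (induced_indep \<theta> Y) xs" "trace_of (induced_indep \<theta> Y) ys"] that assms Y
    by (auto simp: trace_eval_trace_of trace_of_eq_iff)
  show "list_prod M xs = list_prod M ys" if "trace_eq (induced_indep \<theta> Y) xs ys"
    using list_prod_trace_eq[OF that Y assms(2)] .
qed

lemma pc_code_carrier: "pc_code A \<theta> Y \<Longrightarrow> Y \<subseteq> carrier M"
  by (simp add: pc_code_def)

text \<open>
The one-letter word over \<open>1\<close> and the empty word have the same product but different lengths.
\<close>

lemma one_notin_pc_code:
  assumes "pc_code A \<theta> Y"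
  shows "\<one>\<^bsub>M\<^esub> \<notin> Y"
proof
  assume "\<one>\<^bsub>M\<^esub> \<in> Y"
  then have "trace_eq (induced_indep \<theta> Y) [\<one>\<^bsub>M\<^esub>] []"
    using pc_code_iff[OF assms, of "[\<one>\<^bsub>M\<^esub>]" "[]"] by auto
  then show False using trace_eq_mset by fastforce
qed

lemma irrefl_induced_indep:
  assumes "pc_code A \<theta> Y"
  shows "irrefl (induced_indep \<theta> Y)"
proof (rule irreflI)
  fix y show "(y, y) \<notin> induced_indep \<theta> Y"
  proof
    assume y: "(y, y) \<in> induced_indep \<theta> Y"
    then have "y \<in> carrier M" "y \<noteq> \<one>\<^bsub>M\<^esub>"
      using pc_code_carrier[OF assms] one_notin_pc_code[OF assms] by (auto simp: induced_indep_def)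
    then have "Alph y \<noteq> {}" by (simp add: Alph_eq_multidegree multidegree_empty_iff)
    then show False using y irrefl_theta by (auto simp: induced_indep_def irrefl_def)
  qed
qed

lemma beta_in_iff:
  assumes "Y \<subseteq> carrier M" "B \<subseteq> Y"
  shows "w \<in> beta_in A \<theta> Y B \<longleftrightarrow> (\<exists>z\<in>Y - B. \<exists>v\<in>lists B. w = list_prod M (z # v) \<and>
    IA Y (induced_indep \<theta> Y) (trace_of (induced_indep \<theta> Y) (z # v)) = {z})"
proof -
  let ?I = "induced_indep \<theta> Y"
  have carrier: "carrier (trace_monoid B (?I \<inter> B \<times> B)) = trace_of ?I ` lists B"
    unfolding carrier_trace_monoid by (intro image_cong HOL.refl trace_of_restrict) auto
  have "x \<in> beta Y ?I B \<longleftrightarrow> (\<exists>z\<in>Y - B. \<exists>t\<in>trace_of ?I ` lists B.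
      x = trace_of ?I [z] \<otimes>\<^bsub>trace_monoid Y ?I\<^esub> t \<and>
      IA Y ?I (trace_of ?I [z] \<otimes>\<^bsub>trace_monoid Y ?I\<^esub> t) = {z})" for x
    unfolding beta_def carrier mem_Collect_eq by metis
  then have beta: "x \<in> beta Y ?I B \<longleftrightarrow> (\<exists>z\<in>Y - B. \<exists>v\<in>lists B. x = trace_of ?I (z # v) \<and>
      IA Y ?I (trace_of ?I (z # v)) = {z})" for x
    by simp
  have eval: "trace_eval A \<theta> (trace_of ?I (z # v)) = list_prod M (z # v)"
    if "z \<in> Y - B" "v \<in> lists B" for z v
    using that assms by (intro trace_eval_trace_of) auto
  show ?thesis
  proof
    assume "w \<in> beta_in A \<theta> Y B"
    then obtain x where x: "w = trace_eval A \<theta> x" "x \<in> beta Y ?I B" unfolding beta_in_def by (rule imageE)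
    from x(2)[unfolded beta] obtain z v where zv: "z \<in> Y - B" "v \<in> lists B"
        "x = trace_of ?I (z # v)" "IA Y ?I (trace_of ?I (z # v)) = {z}" by blast
    then have "w = list_prod M (z # v)" using x(1) eval by simp
    with zv show "\<exists>z\<in>Y - B. \<exists>v\<in>lists B. w = list_prod M (z # v) \<and> IA Y ?I (trace_of ?I (z # v)) = {z}"
      by blast
  next
    assume "\<exists>z\<in>Y - B. \<exists>v\<in>lists B. w = list_prod M (z # v) \<and> IA Y ?I (trace_of ?I (z # v)) = {z}"
    then obtain z v where zv: "z \<in> Y - B" "v \<in> lists B" "w = list_prod M (z # v)"
        "IA Y ?I (trace_of ?I (z # v)) = {z}" by blast
    then have "trace_of ?I (z # v) \<in> beta Y ?I B" unfolding beta by blast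
    then show "w \<in> beta_in A \<theta> Y B" unfolding beta_in_def using eval zv by (metis imageI)
  qed
qed

lemma beta_inE:
  assumes "w \<in> beta_in A \<theta> Y B" "Y \<subseteq> carrier M" "B \<subseteq> Y"
  obtains z v where "z \<in> Y - B" "v \<in> lists B" "w = list_prod M (z # v)"
  using assms(1) unfolding beta_in_iff[OF assms(2,3)] by (elim bexE conjE)

lemma beta_in_subset:
  assumes "Y \<subseteq> carrier M" "B \<subseteq> Y"
  shows "beta_in A \<theta> Y B \<subseteq> gen_submonoid M Y"
proof
  fix w assume "w \<in> beta_in A \<theta> Y B"
  then obtain z v where "z \<in> Y - B" "v \<in> lists B" "w = list_prod M (z # v)"
    using assms by (rule beta_inE)
  then show "w \<in> gen_submonoid M Y"
    unfolding gen_submonoid_def using assms by (intro image_eqI[of _ _ "z # v"]) auto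
qed

text \<open>
The dichotomy behind elimination: in the first case \<open>z v\<close> qualifies for \<open>\<beta>\<^sub>Z(B)\<close>, and in the second case the
iterated bracket over \<open>z v\<close> can be reordered to begin with the bracket of two independent letters.
\<close>

lemma initial_letter_cases:
  assumes "irrefl \<rho>" "sym \<rho>" "B \<subseteq> Y" "z \<in> Y" "v \<in> lists B"
  obtains "IA Y \<rho> (trace_of \<rho> (z # v)) = {z}"
  | b v' where "b \<in> B" "(z, b) \<in> \<rho>" "trace_eq \<rho> v (b # v')"
proof (cases "IA Y \<rho> (trace_of \<rho> (z # v)) = {z}")
  case False
  have "z \<in> IA Y \<rho> (trace_of \<rho> (z # v))"
    using assms by (auto simp: IA_def carrier_trace_monoid intro!: bexI[of _ v])
  with False obtain b where "b \<in> IA Y \<rho> (trace_of \<rho> (z # v))" "b \<noteq> z" by blast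
  then obtain u where "trace_eq \<rho> (z # v) (b # u)" "b \<noteq> z"
    by (auto simp: IA_def carrier_trace_monoid trace_of_eq_iff)
  then obtain v' where "(z, b) \<in> \<rho>" "trace_eq \<rho> v (b # v')"
    using trace_eq_Cons_distinct assms(2) by metis
  moreover from this have "b \<in> B" using trace_eq_set assms(5) by fastforce
  ultimately show thesis using that by blast
qed (use that in blast)


section \<open>Components of a composition of bisections\<close>

lemma transitive_bisectionD:
  "transitive_bisection A \<theta> (Y, B) \<Longrightarrow> pc_code A \<theta> Y \<and> B \<subseteq> Y"
  by (simp add: transitive_bisection_def TFSA_def)

text \<open>
A nonempty product of elements of \<open>\<beta>\<^sub>Z(B)\<close> contains a letter of \<open>Z = Y - B\<close>, and since \<open>Y\<close> is a code this cannot
be undone by rewriting it over \<open>B\<close>.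
\<close>

lemma gen_submonoid_bisection_trivial:
  assumes Y: "pc_code A \<theta> Y" and B: "B \<subseteq> Y"
  shows "gen_submonoid M B \<inter> gen_submonoid M (beta_in A \<theta> Y B) \<subseteq> {\<one>\<^bsub>M\<^esub>}"
proof
  fix t assume t: "t \<in> gen_submonoid M B \<inter> gen_submonoid M (beta_in A \<theta> Y B)"
  note YM = pc_code_carrier[OF Y]
  obtain bs where bs: "set bs \<subseteq> B" "t = list_prod M bs"
    using t by (auto simp: gen_submonoid_def)
  obtain ws where ws: "set ws \<subseteq> beta_in A \<theta> Y B" "t = list_prod M ws"
    using t by (auto simp: gen_submonoid_def)
  show "t \<in> {\<one>\<^bsub>M\<^esub>}"
  proof (cases ws)
    case Nil
    then show ?thesis using ws by simp
  next
    case (Cons w ws')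
    have "w \<in> beta_in A \<theta> Y B" using ws Cons by simp
    then obtain z v where zv: "z \<in> Y - B" "v \<in> lists B" "w = list_prod M (z # v)"
      using YM B by (rule beta_inE)
    have "set ws' \<subseteq> gen_submonoid M Y"
      using ws Cons beta_in_subset[OF YM B] by auto
    then have "list_prod M ws' \<in> gen_submonoid M Y"
      by (rule gen_submonoid_list_prod[OF YM])
    then obtain ys where ys: "set ys \<subseteq> Y" "list_prod M ws' = list_prod M ys"
      by (auto simp: gen_submonoid_def)
    have zvY: "set (z # v) \<subseteq> Y" using zv B by auto
    have "set ys \<subseteq> carrier M" "set (z # v) \<subseteq> carrier M" using zvY ys(1) YM by blast+
    then have "list_prod M ((z # v) @ ys) = w \<otimes>\<^bsub>M\<^esub> list_prod M ws'"
      unfolding zv(3) ys(2) by (intro list_prod_append)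
    then have "list_prod M bs = list_prod M ((z # v) @ ys)"
      using bs(2) ws(2) Cons by simp
    then have "trace_eq (induced_indep \<theta> Y) bs ((z # v) @ ys)"
      using pc_code_iff[OF Y, of bs "(z # v) @ ys"] bs B zvY ys by auto
    then have "z \<in> set bs" using trace_eq_set by fastforce
    then show ?thesis using bs zv by auto
  qed
qed

text \<open>
The part of the uniqueness of factorizations that is needed to locate a trace in one component. It is
phrased for lists, where the empty set may occur several times as a component.
\<close>

definition trivially_meeting :: "'a trace set list \<Rightarrow> bool" where
  "trivially_meeting Ys \<longleftrightarrow> sorted_wrt (\<lambda>X Y. gen_submonoid M X \<inter> gen_submonoid M Y \<subseteq> {\<one>\<^bsub>M\<^esub>}) Ys"

lemma letters_subset: "letters A \<theta> \<subseteq> carrier M"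
  by (auto simp: letters_def intro!: trace_of_closed)

lemma bisections_compose_invariants:
  assumes "bisections_compose A \<theta> f Ys"
  shows "(\<forall>Y\<in>set Ys. Y \<subseteq> carrier M) \<and> trivially_meeting Ys"
  using assms
proof (induction rule: bisections_compose.induct)
  case Nil
  show ?case by (simp add: trivially_meeting_def letters_subset)
next
  case (Cons f Ls Y Rs B)
  then have Y: "pc_code A \<theta> Y" "B \<subseteq> Y" using transitive_bisectionD by blast+
  note YM = pc_code_carrier[OF Y(1)]
  have BY: "B \<subseteq> gen_submonoid M Y" using Y(2) gen_submonoid_base[OF YM] by blast
  have sub: "gen_submonoid M B \<subseteq> gen_submonoid M Y"
      "gen_submonoid M (beta_in A \<theta> Y B) \<subseteq> gen_submonoid M Y"
    by (intro gen_submonoid_mono YM BY beta_in_subset Y(2))+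
  have car: "beta_in A \<theta> Y B \<subseteq> carrier M" "B \<subseteq> carrier M"
    using beta_in_subset[OF YM Y(2)] gen_submonoid_closed[OF YM] Y(2) YM by blast+
  have triv: "gen_submonoid M B \<inter> gen_submonoid M (beta_in A \<theta> Y B) \<subseteq> {\<one>\<^bsub>M\<^esub>}"
    by (rule gen_submonoid_bisection_trivial[OF Y])
  show ?case
  proof
    show "\<forall>Y\<in>set (Ls @ [B, beta_in A \<theta> Y B] @ Rs). Y \<subseteq> carrier M"
      using Cons.IH car by auto
    have "trivially_meeting (Ls @ Y # Rs)" using Cons.IH by blast
    then show "trivially_meeting (Ls @ [B, beta_in A \<theta> Y B] @ Rs)"
      unfolding trivially_meeting_def sorted_wrt_append using sub triv
      by (auto 0 3 simp: subset_iff)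
  qed
qed

lemma trivially_meeting_split:
  assumes "trivially_meeting (Ls @ Y # Rs)" "X \<in> set (Ls @ Rs)"
  shows "gen_submonoid M X \<inter> gen_submonoid M Y \<subseteq> {\<one>\<^bsub>M\<^esub>}"
  using assms unfolding trivially_meeting_def sorted_wrt_append by auto

text \<open>
A list of bisections may compose to several families, because an empty component \<open>Y\<close> can be split at
any of its positions. Up to empty components the result is determined: a nonempty code occurs only once
in a trivially meeting list, as it would meet itself.
\<close>

lemma bisections_compose_unique:
  assumes "bisections_compose A \<theta> f Ys" "bisections_compose A \<theta> f Ys'"
  shows "set Ys - {{}} = set Ys' - {{}}"
  using assms
proof (induction f arbitrary: Ys Ys')
  case Nil
  then show ?case by (auto elim!: bisections_compose.cases)
next
  case (Cons bis f)
  obtain Y B where bis: "bis = (Y, B)" by fastforce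
  have decomp: "\<exists>Ls Rs. Zs = Ls @ [B, beta_in A \<theta> Y B] @ Rs \<and> bisections_compose A \<theta> f (Ls @ Y # Rs)
      \<and> transitive_bisection A \<theta> (Y, B)"
    if "bisections_compose A \<theta> (bis # f) Zs" for Zs
    using that unfolding bis by cases blast+
  from decomp[OF Cons.prems(1)] obtain Ls Rs
    where 1: "Ys = Ls @ [B, beta_in A \<theta> Y B] @ Rs" "bisections_compose A \<theta> f (Ls @ Y # Rs)"
      and Y: "pc_code A \<theta> Y" "B \<subseteq> Y"
    using transitive_bisectionD by blast
  from decomp[OF Cons.prems(2)] obtain Ls' Rs'
    where 2: "Ys' = Ls' @ [B, beta_in A \<theta> Y B] @ Rs'" "bisections_compose A \<theta> f (Ls' @ Y # Rs')"
    by blast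
  have rest: "set (Xs @ Zs) - {{}} = set (Xs @ Y # Zs) - {{}} - {Y}"
    if "bisections_compose A \<theta> f (Xs @ Y # Zs)" for Xs Zs
  proof (cases "Y = {}")
    case False
    have "Y \<notin> set (Xs @ Zs)"
    proof
      assume "Y \<in> set (Xs @ Zs)"
      then have "gen_submonoid M Y \<inter> gen_submonoid M Y \<subseteq> {\<one>\<^bsub>M\<^esub>}"
        using trivially_meeting_split[of Xs Y Zs] bisections_compose_invariants[OF that] by blast
      then have "Y \<subseteq> {\<one>\<^bsub>M\<^esub>}"
        using gen_submonoid_base[OF pc_code_carrier[OF Y(1)]] by blast
      then show False using False one_notin_pc_code[OF Y(1)] by blast
    qed
    then show ?thesis by auto
  qed auto
  have "set Ls \<union> set Rs - {{}} = set Ls' \<union> set Rs' - {{}}"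
    using rest[OF 1(2)] rest[OF 2(2)] Cons.IH[OF 1(2) 2(2)] by auto
  then show ?case unfolding 1(1) 2(1) by auto
qed

lemma bisections_compose_Union_unique:
  assumes "bisections_compose A \<theta> f Ys" "bisections_compose A \<theta> f Ys'"
  shows "\<Union>(set Ys) = \<Union>(set Ys')"
  using bisections_compose_unique[OF assms] by blast


section \<open>Multihomogeneous elements\<close>

text \<open>
The grading of the algebra is by multisets of letters. Zero is homogeneous of every degree, so that vanishing
brackets are no exception.
\<close>

definition homogeneous :: "('a trace \<Rightarrow>\<^sub>0 'k::comm_ring_1) \<Rightarrow> 'a multiset \<Rightarrow> bool" where
  "homogeneous p m \<longleftrightarrow> (\<forall>t\<in>Poly_Mapping.keys p. t \<in> carrier M \<and> multidegree t = m)"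

lemma homogeneous_single: "t \<in> carrier M \<Longrightarrow> homogeneous (Poly_Mapping.single t a) (multidegree t)"
  by (simp add: homogeneous_def)

lemma homogeneous_diff: "homogeneous p m \<Longrightarrow> homogeneous q m \<Longrightarrow> homogeneous (p - q) m"
  using Poly_Mapping.keys_diff[of p q] by (auto simp: homogeneous_def)

lemma homogeneous_alg_mult:
  assumes "homogeneous p m" "homogeneous q n"
  shows "homogeneous (alg_mult M p q) (m + n)"
  using assms keys_alg_mult[of M p q] unfolding homogeneous_def
  by (fastforce simp: multidegree_mult mult_closed)

lemma homogeneous_lie_bracket:
  assumes "homogeneous p m" "homogeneous q n"
  shows "homogeneous (lie_bracket M p q) (m + n)"
  unfolding lie_bracket_def
  using homogeneous_alg_mult[OF assms] homogeneous_alg_mult[OF assms(2,1)]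
  by (intro homogeneous_diff) (simp_all add: add.commute)

lemma homogeneous_foldl_bracket:
  assumes "homogeneous p m" "\<And>v. v \<in> set vs \<Longrightarrow> homogeneous (g v) (multidegree v)"
  shows "homogeneous (foldl (lie_bracket M) p (map g vs)) (m + (\<Sum>v\<leftarrow>vs. multidegree v))"
  using assms
proof (induction vs arbitrary: p m)
  case (Cons v vs)
  have "homogeneous (foldl (lie_bracket M) (lie_bracket M p (g v)) (map g vs)) ((m + multidegree v) + (\<Sum>v\<leftarrow>vs. multidegree v))"
    using Cons.prems by (intro Cons.IH homogeneous_lie_bracket) auto
  then show ?case by (simp add: add.assoc)
qed simp

text \<open>
Multihomogeneity transfers independence from \<open>s\<close> and \<open>t\<close> to all traces in the supports of
\<open>p\<close> and \<open>q\<close>, which therefore commute.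
\<close>

lemma lie_bracket_independent:
  assumes "homogeneous p (multidegree s)" "homogeneous q (multidegree t)" "(s, t) \<in> induced_indep \<theta> Y" "Y \<subseteq> carrier M"
  shows "lie_bracket M p q = 0"
proof -
  have "set_mset (multidegree s) \<times> set_mset (multidegree t) \<subseteq> \<theta>"
    using assms(3,4) by (auto simp: induced_indep_def Alph_eq_multidegree subset_iff)
  then have "alg_mult M p q = alg_mult M q p"
    using assms(1,2) by (intro alg_mult_commute mult_commute) (auto simp: homogeneous_def)
  then show ?thesis by (simp add: lie_bracket_def)
qed

lemma foldl_bracket_zero: "foldl (lie_bracket M) 0 ps = 0"
  by (induction ps) simp_all

text \<open>
By the Jacobi identity, bracketing with \<open>g a\<close> and bracketing with \<open>g b\<close> commute as soon as
\<open>[g a, g b] = 0\<close>.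
\<close>

lemma foldl_bracket_trace_eq:
  assumes "trace_eq \<rho> u v" "\<And>a b. (a, b) \<in> \<rho> \<Longrightarrow> lie_bracket M (g a) (g b) = 0"
  shows "foldl (lie_bracket M) p (map g u) = foldl (lie_bracket M) p (map g v)"
  using assms(1)
proof (induction arbitrary: p rule: trace_eq.induct)
  case (commute a b)
  show ?case using assms(2)[OF commute] lie_bracket_derivation[of p "g a" "g b"] by simp
qed auto


section \<open>Bracketings of finite transitive factorizations\<close>

text \<open>
The letter outside \<open>B\<close> is determined by the trace, and cancelling it leaves equivalent words over \<open>B\<close>.
\<close>

lemma foldl_bracket_welldefined:
  fixes g :: "'a trace \<Rightarrow> ('a trace \<Rightarrow>\<^sub>0 'k::comm_ring_1)"
  assumes Y: "pc_code A \<theta> Y" "B \<subseteq> Y"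
    and g: "\<And>y. y \<in> Y \<Longrightarrow> homogeneous (g y) (multidegree y)"
    and zv: "z \<in> Y - B" "v \<in> lists B" "z' \<in> Y - B" "v' \<in> lists B"
    and eq: "list_prod M (z # v) = list_prod M (z' # v')"
  shows "foldl (lie_bracket M) (g z) (map g v) = foldl (lie_bracket M) (g z') (map g v')"
proof -
  let ?\<rho> = "induced_indep \<theta> Y"
  have teq: "trace_eq ?\<rho> (z # v) (z' # v')"
    using pc_code_iff[OF Y(1), of "z # v" "z' # v'"] eq zv Y(2) by auto
  then have "z \<in> set (z' # v')" using trace_eq_set by fastforce
  then have "z' = z" using zv by auto
  then have "trace_eq ?\<rho> v v'"
    using trace_eq_Cons_cancel[OF _ sym_induced_indep irrefl_induced_indep[OF Y(1)]] teq by blast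
  moreover have "lie_bracket M (g a) (g b) = 0" if "(a, b) \<in> ?\<rho>" for a b
    using lie_bracket_independent[OF _ _ that pc_code_carrier[OF Y(1)]] g that
    by (auto simp: induced_indep_def)
  ultimately show ?thesis using foldl_bracket_trace_eq \<open>z' = z\<close> by metis
qed

lemma finite_bracketing_unchanged:
  assumes "bisections_compose A \<theta> f Ys" "w \<in> \<Union>(set Ys)"
  shows "finite_bracketing A \<theta> ((Y, B) # f) w = finite_bracketing A \<theta> f w"
  using assms by auto

text \<open>
The equation also holds where the recursion takes its first branch. There the trace \<open>z v\<close> already belongs to an
earlier component, which must be \<open>Y\<close> because the components meet trivially; as \<open>Y\<close> is a code,
\<open>v\<close> is then empty and both sides are the bracketing of \<open>z\<close>.
\<close>

lemma finite_bracketing_iterated_bracket: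
  fixes g :: "'a trace \<Rightarrow> ('a trace \<Rightarrow>\<^sub>0 'k::comm_ring_1)"
  assumes f: "bisections_compose A \<theta> f (Ls @ Y # Rs)" and Y: "pc_code A \<theta> Y" "B \<subseteq> Y"
    and g: "g = finite_bracketing A \<theta> f" "\<And>y. y \<in> Y \<Longrightarrow> homogeneous (g y) (multidegree y)"
    and zv: "z \<in> Y - B" "v \<in> lists B"
  shows "finite_bracketing A \<theta> ((Y, B) # f) (list_prod M (z # v)) = foldl (lie_bracket M) (g z) (map g v)"
proof (cases "\<exists>Ys. bisections_compose A \<theta> f Ys \<and> list_prod M (z # v) \<in> \<Union>(set Ys)")
  case True
  let ?w = "list_prod M (z # v)"
  have zvY: "set (z # v) \<subseteq> Y" using zv Y by auto
  from True have "?w \<in> \<Union>(set (Ls @ Y # Rs))"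
    using bisections_compose_Union_unique[OF f] by blast
  then obtain X where X: "X \<in> set (Ls @ Y # Rs)" "?w \<in> X" by blast
  have "?w \<in> Y"
  proof (rule ccontr)
    assume "?w \<notin> Y"
    then have "X \<in> set (Ls @ Rs)" using X by auto
    then have "gen_submonoid M X \<inter> gen_submonoid M Y \<subseteq> {\<one>\<^bsub>M\<^esub>}"
      using trivially_meeting_split bisections_compose_invariants[OF f] by blast
    moreover have "?w \<in> gen_submonoid M X"
      using X gen_submonoid_base[of X] bisections_compose_invariants[OF f] by blast
    moreover have "?w \<in> gen_submonoid M Y"
      unfolding gen_submonoid_def using zvY by (intro imageI) auto
    ultimately have "?w = list_prod M []" by (simp del: list_prod_simps(2)) blast
    then have "trace_eq (induced_indep \<theta> Y) (z # v) []"
      using pc_code_iff[OF Y(1), of "z # v" "[]"] zvY by (simp del: list_prod_simps)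
    then show False using trace_eq_mset by fastforce
  qed
  moreover have "list_prod M [?w] = ?w"
    using list_prod_closed[of "z # v"] zvY pc_code_carrier[OF Y(1)] by (simp only: list_prod_simps mult_one)
  ultimately have "trace_eq (induced_indep \<theta> Y) [?w] (z # v)"
    using pc_code_iff[OF Y(1), of "[?w]" "z # v"] zvY by (simp del: list_prod_simps)
  then have "mset [?w] = mset (z # v)" by (rule trace_eq_mset)
  then have v: "v = []" and wz: "?w = z" by (auto dest: arg_cong[where f = size] simp del: list_prod_simps)
  have "finite_bracketing A \<theta> ((Y, B) # f) ?w = g ?w"
    using True unfolding g(1) by (simp del: list_prod_simps)
  also have "\<dots> = g z" unfolding wz by (rule HOL.refl)
  also have "\<dots> = foldl (lie_bracket M) (g z) (map g v)" by (simp add: v)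
  finally show ?thesis .
next
  case False
  have "finite_bracketing A \<theta> ((Y, B) # f) (list_prod M (z # v)) =
    (THE p. \<exists>y \<in> Y - B. \<exists>vs \<in> lists B. list_prod M (z # v) = list_prod M (y # vs) \<and>
       p = foldl (lie_bracket M) (g y) (map g vs))"
    unfolding g(1) finite_bracketing.simps(2) by (rule if_not_P[OF False])
  also have "\<dots> = foldl (lie_bracket M) (g z) (map g v)"
    using zv foldl_bracket_welldefined[OF Y g(2)] by (intro the_equality) metis+
  finally show ?thesis .
qed

lemma homogeneous_finite_bracketing:
  assumes "bisections_compose A \<theta> f Ys" "w \<in> \<Union>(set Ys)"
  shows "homogeneous (finite_bracketing A \<theta> f w :: 'a trace \<Rightarrow>\<^sub>0 'k::comm_ring_1) (multidegree w)"
  using assms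
proof (induction arbitrary: w rule: bisections_compose.induct)
  case Nil
  then show ?case using letters_subset homogeneous_single by auto
next
  case (Cons f Ls Y Rs B)
  have Y: "pc_code A \<theta> Y" "B \<subseteq> Y" using Cons.hyps(2) transitive_bisectionD by blast+
  note YM = pc_code_carrier[OF Y(1)]
  show ?case
  proof (cases "w \<in> \<Union>(set (Ls @ Y # Rs))")
    case True
    then show ?thesis
      unfolding finite_bracketing_unchanged[OF Cons.hyps(1) True] by (rule Cons.IH)
  next
    case False
    then have "w \<in> beta_in A \<theta> Y B" using Cons.prems Y(2) by auto
    then obtain z v where zv: "z \<in> Y - B" "v \<in> lists B" "w = list_prod M (z # v)"
      using YM Y(2) by (rule beta_inE)
    have g: "homogeneous (finite_bracketing A \<theta> f y :: 'a trace \<Rightarrow>\<^sub>0 'k) (multidegree y)" if "y \<in> Y" for y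
      using Cons.IH that by auto
    have "multidegree w = multidegree z + (\<Sum>x\<leftarrow>v. multidegree x)"
      using zv Y(2) YM multidegree_list_prod[of "z # v"] by auto
    moreover have "finite_bracketing A \<theta> ((Y, B) # f) w = foldl (lie_bracket M)
        (finite_bracketing A \<theta> f z) (map (finite_bracketing A \<theta> f) v :: ('a trace \<Rightarrow>\<^sub>0 'k) list)"
      unfolding zv(3) by (rule finite_bracketing_iterated_bracket[OF Cons.hyps(1) Y HOL.refl g zv(1,2)])
    moreover have "homogeneous (foldl (lie_bracket M)
        (finite_bracketing A \<theta> f z) (map (finite_bracketing A \<theta> f) v :: ('a trace \<Rightarrow>\<^sub>0 'k) list))
        (multidegree z + (\<Sum>x\<leftarrow>v. multidegree x))"
      using zv Y(2) by (intro homogeneous_foldl_bracket g) auto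
    ultimately show ?thesis by (simp only:)
  qed
qed

text \<open>
Elimination for one bisection. The iterated brackets over \<open>z v\<close> with \<open>v\<close> an arbitrary word over \<open>B\<close> are stable
under bracketing with \<open>B\<close>, and they are either bracketings of elements of \<open>\<beta>\<^sub>Z(B)\<close> or zero: if \<open>z v\<close> has another
initial letter \<open>b\<close>, then the bracket can be reordered to begin with \<open>[z, b] = 0\<close>.
\<close>

lemma lie_hull_bisection:
  fixes g g' :: "'a trace \<Rightarrow> ('a trace \<Rightarrow>\<^sub>0 'k::comm_ring_1)"
  assumes Y: "pc_code A \<theta> Y" "B \<subseteq> Y"
    and g: "\<And>y. y \<in> Y \<Longrightarrow> homogeneous (g y) (multidegree y)"
    and g': "\<And>z v. z \<in> Y - B \<Longrightarrow> v \<in> lists B \<Longrightarrow>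
      g' (list_prod M (z # v)) = foldl (lie_bracket M) (g z) (map g v)"
  shows "lie_closed M hull (g ` Y) \<subseteq>
    pm.span (lie_closed M hull (g ` B) \<union> lie_closed M hull (g' ` beta_in A \<theta> Y B))"
proof -
  let ?\<rho> = "induced_indep \<theta> Y" and ?X = "g' ` beta_in A \<theta> Y B"
  note YM = pc_code_carrier[OF Y(1)]
  note initial_cases = initial_letter_cases[OF irrefl_induced_indep[OF Y(1)] sym_induced_indep Y(2)]
  have comm: "lie_bracket M (g a) (g b) = 0" if "(a, b) \<in> ?\<rho>" for a b
    using lie_bracket_independent[OF _ _ that YM] g that by (auto simp: induced_indep_def)
  have iterated: "foldl (lie_bracket M) (g z) (map g v) \<in> insert 0 ?X"
    if zv: "z \<in> Y - B" "v \<in> lists B" for z v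
  proof -
    have "z \<in> Y" using zv by simp
    from this zv(2) show ?thesis
    proof (cases rule: initial_cases[consumes 2])
      case 1
      then have "list_prod M (z # v) \<in> beta_in A \<theta> Y B"
        unfolding beta_in_iff[OF YM Y(2)] using zv
        by (intro bexI[of _ z] bexI[of _ v] conjI) (rule HOL.refl | assumption)+
      then show ?thesis using g'[OF zv] by (metis imageI insertCI)
    next
      case (2 b v')
      have "foldl (lie_bracket M) (g z) (map g v) = foldl (lie_bracket M) (g z) (map g (b # v'))"
        using 2(3) comm by (rule foldl_bracket_trace_eq)
      also have "\<dots> = 0" using comm[OF 2(2)] by (simp add: foldl_bracket_zero)
      finally show ?thesis by simp
    qed
  qed
  have "lie_bracket M x e \<in> lie_closed M hull ?X" if "x \<in> ?X" "e \<in> g ` B" for x e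
  proof -
    obtain w b where wb: "w \<in> beta_in A \<theta> Y B" "x = g' w" "b \<in> B" "e = g b" using \<open>x \<in> ?X\<close> \<open>e \<in> g ` B\<close> by blast
    from wb(1) YM Y(2) obtain z v where zv: "z \<in> Y - B" "v \<in> lists B" "w = list_prod M (z # v)"
      by (rule beta_inE)
    have "lie_bracket M x e = foldl (lie_bracket M) (g z) (map g (v @ [b]))"
      unfolding wb zv(3) g'[OF zv(1,2)] by simp
    moreover have "foldl (lie_bracket M) (g z) (map g (v @ [b])) \<in> insert 0 ?X"
      by (rule iterated) (use zv wb in auto)
    ultimately show ?thesis
      using hull_inc pm.subspace_0[OF subspace_lie_hull] by (metis insertE)
  qed
  then have "lie_closed M hull (g ` B \<union> ?X) \<subseteq> pm.span (lie_closed M hull (g ` B) \<union> lie_closed M hull ?X)"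
    by (rule lie_hull_elimination)
  moreover have "g y \<in> lie_closed M hull (g ` B \<union> ?X)" if "y \<in> Y" for y
  proof (cases "y \<in> B")
    case False
    then have "g y \<in> insert 0 ?X" using iterated[of y "[]"] that by simp
    then show ?thesis
      using hull_inc[of "g y" "g ` B \<union> ?X"] pm.subspace_0[OF subspace_lie_hull, of M "g ` B \<union> ?X"] by auto
  qed (auto intro: hull_inc)
  then have "lie_closed M hull (g ` Y) \<subseteq> lie_closed M hull (g ` B \<union> ?X)"
    by (intro hull_minimal lie_closed_hull) auto
  ultimately show ?thesis by blast
qed

text \<open>
Iterated elimination: the free partially commutative Lie algebra is contained in the sum of the Lie algebras
of the components.
\<close>

lemma lie_hull_letters_subset:
  assumes "bisections_compose A \<theta> f Ys"
  shows "lie_closed M hull ((\<lambda>t. Poly_Mapping.single t (1::'k::comm_ring_1)) ` letters A \<theta>) \<subseteq>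
    pm.span (\<Union>Y\<in>set Ys. lie_closed M hull (finite_bracketing A \<theta> f ` Y))"
  using assms
proof (induction rule: bisections_compose.induct)
  case Nil
  have "finite_bracketing A \<theta> [] = (\<lambda>t. Poly_Mapping.single t (1::'k))" by auto
  then show ?case by (auto intro: pm.span_base)
next
  case (Cons f Ls Y Rs B)
  define g where "g = (finite_bracketing A \<theta> f :: 'a trace \<Rightarrow> ('a trace \<Rightarrow>\<^sub>0 'k))"
  define g' where "g' = (finite_bracketing A \<theta> ((Y, B) # f) :: 'a trace \<Rightarrow> ('a trace \<Rightarrow>\<^sub>0 'k))"
  have Y: "pc_code A \<theta> Y" "B \<subseteq> Y" using Cons.hyps(2) transitive_bisectionD by blast+
  have old: "g' w = g w" if "w \<in> \<Union>(set (Ls @ Y # Rs))" for w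
    unfolding g_def g'_def using finite_bracketing_unchanged[OF Cons.hyps(1) that] .
  have hom: "homogeneous (g y) (multidegree y)" if "y \<in> Y" for y
    unfolding g_def using homogeneous_finite_bracketing[OF Cons.hyps(1)] that by auto
  have new: "g' (list_prod M (z # v)) = foldl (lie_bracket M) (g z) (map g v)"
    if "z \<in> Y - B" "v \<in> lists B" for z v
    unfolding g'_def by (rule finite_bracketing_iterated_bracket[OF Cons.hyps(1) Y g_def hom that])
  let ?S = "\<lambda>X. lie_closed M hull (g' ` X)"
  let ?U = "pm.span (\<Union>X\<in>set (Ls @ [B, beta_in A \<theta> Y B] @ Rs). ?S X)"
  have sub: "lie_closed M hull (g ` X) \<subseteq> ?U" if "X \<in> set (Ls @ Y # Rs)" for X
  proof (cases "X \<in> set (Ls @ Rs)")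
    case True
    have "g' ` X = g ` X" by (rule image_cong[OF HOL.refl], rule old) (use that in blast)
    moreover have "?S X \<subseteq> ?U" using True by (auto intro: pm.span_base)
    ultimately show ?thesis by simp
  next
    case False
    then have X: "X = Y" using that by auto
    have gB: "g' ` B = g ` B" by (rule image_cong[OF HOL.refl], rule old) (use Y(2) in auto)
    have "lie_closed M hull (g ` Y) \<subseteq> pm.span (?S B \<union> ?S (beta_in A \<theta> Y B))"
      using lie_hull_bisection[OF Y hom new] by (simp only: gB)
    also have "\<dots> \<subseteq> ?U" by (rule pm.span_mono) auto
    finally show ?thesis using X by simp
  qed
  have "pm.span (\<Union>X\<in>set (Ls @ Y # Rs). lie_closed M hull (g ` X)) \<subseteq> ?U"
    by (rule pm.span_minimal) (use sub in blast, rule pm.subspace_span)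
  then show ?case using Cons.IH unfolding g_def g'_def by blast
qed


section \<open>Generation: truncation to finitely many traces\<close>

lemma lie_closed_carrier_supported:
  "lie_closed M {p :: 'a trace \<Rightarrow>\<^sub>0 'k::comm_ring_1. Poly_Mapping.keys p \<subseteq> carrier M}" (is "lie_closed M ?V")
proof (rule lie_closedI)
  have mult: "alg_mult M p q \<in> ?V" if "p \<in> ?V" "q \<in> ?V" for p q :: "'a trace \<Rightarrow>\<^sub>0 'k"
    using that keys_alg_mult[of M p q] by (fastforce intro: mult_closed)
  fix p q :: "'a trace \<Rightarrow>\<^sub>0 'k" and c
  assume p: "p \<in> ?V"
  then show "pm_scale c p \<in> ?V" using keys_pm_scale[of c p] by auto
  assume q: "q \<in> ?V"
  show "p + q \<in> ?V" using p q Poly_Mapping.keys_add[of p q] by auto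
  show "lie_bracket M p q \<in> ?V"
    using mult[OF p q] mult[OF q p] Poly_Mapping.keys_diff[of "alg_mult M p q" "alg_mult M q p"]
    by (auto simp: lie_bracket_def)
qed simp

lemma keys_lie_hull_letters:
  assumes "p \<in> lie_closed M hull ((\<lambda>t. Poly_Mapping.single t (1::'k::comm_ring_1)) ` letters A \<theta>)"
  shows "Poly_Mapping.keys p \<subseteq> carrier M"
proof -
  have "lie_closed M hull ((\<lambda>t. Poly_Mapping.single t (1::'k)) ` letters A \<theta>)
      \<subseteq> {p. Poly_Mapping.keys p \<subseteq> carrier M}"
    using letters_subset by (intro hull_minimal lie_closed_carrier_supported) auto
  then show ?thesis using assms by blast
qed

lemma free_pc_lie_eq:
  "free_pc_lie A \<theta> = lie_closed M hull ((\<lambda>t. Poly_Mapping.single t (1::'k::comm_ring_1)) ` letters A \<theta>)"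
    (is "_ = lie_closed M hull ?S")
proof
  have sub: "lie_subalgebra M V \<longleftrightarrow> V \<subseteq> monoid_algebra M \<and> lie_closed M V" for V :: "('a trace \<Rightarrow>\<^sub>0 'k) set"
    by (simp add: lie_subalgebra_def lie_closed_def)
  have "lie_subalgebra M (lie_closed M hull ?S)"
    unfolding sub monoid_algebra_def using keys_lie_hull_letters lie_closed_hull by blast
  then show "free_pc_lie A \<theta> \<subseteq> lie_closed M hull ?S"
    unfolding free_pc_lie_def by (intro hull_minimal hull_subset)
  show "lie_closed M hull ?S \<subseteq> free_pc_lie A \<theta>"
    unfolding free_pc_lie_def by (intro hull_antimono) (simp add: sub)
qed

lemma restrict_keys_alg_mult:
  assumes T: "\<And>s t. s \<in> carrier M \<Longrightarrow> t \<in> carrier M \<Longrightarrow> s \<otimes>\<^bsub>M\<^esub> t \<in> T \<Longrightarrow> s \<in> T \<and> t \<in> T"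
    and p: "Poly_Mapping.keys (p :: 'a trace \<Rightarrow>\<^sub>0 'k::comm_ring_1) \<subseteq> carrier M"
    and q: "Poly_Mapping.keys q \<subseteq> carrier M"
  shows "restrict_keys T (alg_mult M p q) = restrict_keys T (alg_mult M (restrict_keys T p) (restrict_keys T q))"
proof -
  let ?p = "restrict_keys T p" and ?q = "restrict_keys T q"
  have kp: "Poly_Mapping.keys (p - ?p) \<inter> T = {}" "Poly_Mapping.keys (p - ?p) \<subseteq> carrier M"
    using p by (auto simp: in_keys_iff lookup_minus lookup_restrict_keys split: if_splits)
  have kq: "Poly_Mapping.keys (q - ?q) \<inter> T = {}" "Poly_Mapping.keys (q - ?q) \<subseteq> carrier M"
    using q by (auto simp: in_keys_iff lookup_minus lookup_restrict_keys split: if_splits)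
  have kp': "Poly_Mapping.keys ?p \<subseteq> carrier M" using p by (auto simp: keys_restrict_keys)
  have outside: "Poly_Mapping.keys (alg_mult M x y) \<inter> T = {}"
    if "Poly_Mapping.keys x \<subseteq> carrier M" "Poly_Mapping.keys y \<subseteq> carrier M"
      "Poly_Mapping.keys x \<inter> T = {} \<or> Poly_Mapping.keys y \<inter> T = {}" for x y :: "'a trace \<Rightarrow>\<^sub>0 'k"
  proof (rule ccontr)
    assume "Poly_Mapping.keys (alg_mult M x y) \<inter> T \<noteq> {}"
    then obtain m where m: "m \<in> Poly_Mapping.keys (alg_mult M x y)" "m \<in> T" by blast
    then obtain s t where st: "s \<in> Poly_Mapping.keys x" "t \<in> Poly_Mapping.keys y" "m = s \<otimes>\<^bsub>M\<^esub> t"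
      using keys_alg_mult[of M x y] by auto
    then have "s \<in> T \<and> t \<in> T" using T[of s t] that(1,2) m(2) by auto
    then show False using that(3) st by blast
  qed
  have "Poly_Mapping.keys (alg_mult M (p - ?p) q) \<inter> T = {}"
    by (rule outside) (use kp q in auto)
  moreover have "Poly_Mapping.keys (alg_mult M ?p (q - ?q)) \<inter> T = {}"
    by (rule outside) (use kq kp' in auto)
  moreover have "alg_mult M p q = alg_mult M ?p ?q + alg_mult M (p - ?p) q + alg_mult M ?p (q - ?q)"
    by (simp add: alg_mult_diff_left alg_mult_diff_right)
  ultimately show ?thesis by (simp add: restrict_keys_add restrict_keys_disjoint)
qed

text \<open>
Truncation discards the brackets that involve a discarded generator, because factors of surviving
traces survive. Of the Lie algebra generated by the bracketings of \<open>Y\<close> this leaves the one generated by a single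
element, which is the module spanned by it, since \<open>[p, p] = 0\<close>.
\<close>

lemma restrict_keys_lie_hull:
  fixes g :: "'a trace \<Rightarrow> ('a trace \<Rightarrow>\<^sub>0 'k::comm_ring_1)"
  assumes g: "\<And>y. y \<in> Y \<Longrightarrow> homogeneous (g y) (multidegree y)" and Y: "Y \<subseteq> carrier M"
    and T: "T = traces_upto \<theta> B n" and one: "Y \<inter> T \<subseteq> {l}"
    and p: "p \<in> lie_closed M hull (g ` Y)"
  shows "restrict_keys T p \<in> pm.span (g ` (Y \<inter> T))"
proof -
  let ?W = "pm.span (g ` (Y \<inter> T))"
  let ?V = "{p. Poly_Mapping.keys p \<subseteq> carrier M} \<inter> {p. restrict_keys T p \<in> ?W}"
  have factor: "s \<in> T \<and> t \<in> T" if "s \<in> carrier M" "t \<in> carrier M" "s \<otimes>\<^bsub>M\<^esub> t \<in> T" for s t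
    using that mult_closed[of s t] by (auto simp: T traces_upto_iff multidegree_mult)
  have mono: "x \<in> range (\<lambda>c. pm_scale c (g l))" if "x \<in> ?W" for x
    using pm.span_mono[of "g ` (Y \<inter> T)" "{g l}"] one that unfolding pm.span_singleton by blast
  have "lie_closed M ?V"
  proof (rule lie_closed_def[THEN iffD2], intro conjI ballI)
    show "pm.subspace ?V"
      using lie_closed_carrier_supported[where 'k = 'k] unfolding lie_closed_def
      by (intro pm.subspace_inter subspace_restrict_keys_preimage pm.subspace_span) blast
    fix p q assume p: "p \<in> ?V" and q: "q \<in> ?V"
    have "restrict_keys T (lie_bracket M p q)
        = restrict_keys T (lie_bracket M (restrict_keys T p) (restrict_keys T q))"
      using p q unfolding lie_bracket_def restrict_keys_diff
      by (simp add: restrict_keys_alg_mult[OF factor, of p q] restrict_keys_alg_mult[OF factor, of q p])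
    moreover obtain c d where "restrict_keys T p = pm_scale c (g l)" "restrict_keys T q = pm_scale d (g l)"
      using mono p q by blast
    ultimately have "restrict_keys T (lie_bracket M p q) = 0"
      by (simp add: lie_bracket_scale_left lie_bracket_scale_right)
    moreover have "Poly_Mapping.keys (lie_bracket M p q) \<subseteq> carrier M"
      using p q lie_closed_carrier_supported[where 'k = 'k] unfolding lie_closed_def by blast
    ultimately show "lie_bracket M p q \<in> ?V" by (simp add: pm.span_zero)
  qed
  moreover have "g y \<in> ?V" if y: "y \<in> Y" for y
  proof -
    have keys: "t \<in> carrier M" "t \<in> T \<longleftrightarrow> y \<in> T" if "t \<in> Poly_Mapping.keys (g y)" for t
      using g[OF y] that Y y by (auto simp: homogeneous_def T traces_upto_iff subset_iff)
    have "restrict_keys T (g y) \<in> ?W"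
    proof (cases "y \<in> T")
      case True
      then have "restrict_keys T (g y) = g y" using keys by (intro restrict_keys_id) blast
      then show ?thesis using True y by (auto intro: pm.span_base)
    next
      case False
      then have "restrict_keys T (g y) = 0" using keys by (intro restrict_keys_disjoint) blast
      then show ?thesis by (simp add: pm.span_zero)
    qed
    then show ?thesis using keys by blast
  qed
  then have "g ` Y \<subseteq> ?V" by blast
  ultimately have "lie_closed M hull (g ` Y) \<subseteq> ?V" by (intro hull_minimal)
  then show ?thesis using p by blast
qed

lemma bracketing_localE:
  assumes br: "bracketing A \<theta> I Y P" and B: "finite B" "B \<subseteq> A"
  obtains Ys f \<phi> where "bisections_compose A \<theta> f Ys"
    "\<forall>t \<in> \<Union>(set Ys) \<inter> traces_upto \<theta> B n. P t = finite_bracketing A \<theta> f t"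
    "\<phi> ` {..<length Ys} \<subseteq> I"
    "\<forall>k<length Ys. Ys ! k \<inter> traces_upto \<theta> B n = Y (\<phi> k) \<inter> traces_upto \<theta> B n"
    "\<forall>j \<in> I - \<phi> ` {..<length Ys}. Y j \<inter> traces_upto \<theta> B n = {}"
proof -
  have "\<exists>Ys f. local_model A \<theta> I Y n B Ys \<and> bisections_compose A \<theta> f Ys \<and>
        (\<forall>t \<in> \<Union>(set Ys) \<inter> traces_upto \<theta> B n. P t = finite_bracketing A \<theta> f t)"
    using conjunct2[OF br[unfolded bracketing_def], THEN spec, THEN spec, of B n] B by (elim mp) simp
  then show thesis
    unfolding local_model_def by (elim exE conjE) (rule that)
qed

text \<open>
A trace of the factorization lies in each local model that is large enough to see it, where the bracketing
is a finite one.
\<close>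

lemma bracketing_homogeneous:
  fixes P :: "'a trace \<Rightarrow> ('a trace \<Rightarrow>\<^sub>0 'k::comm_ring_1)"
  assumes br: "bracketing A \<theta> I Y P" and t: "t \<in> (\<Union>i\<in>I. Y i)" "t \<in> carrier M"
  shows "homogeneous (P t) (multidegree t)"
proof -
  define B where "B = set_mset (multidegree t)"
  define n where "n = size (multidegree t)"
  have B: "finite B" "B \<subseteq> A" using t(2) by (auto simp: B_def elim!: carrierE)
  have tT: "t \<in> traces_upto \<theta> B n" using t(2) by (simp add: traces_upto_iff B_def n_def)
  obtain Ys f \<phi> where Ys: "bisections_compose A \<theta> f Ys"
    and P: "\<forall>t \<in> \<Union>(set Ys) \<inter> traces_upto \<theta> B n. P t = finite_bracketing A \<theta> f t"
    and \<phi>: "\<forall>k<length Ys. Ys ! k \<inter> traces_upto \<theta> B n = Y (\<phi> k) \<inter> traces_upto \<theta> B n"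
      "\<forall>j \<in> I - \<phi> ` {..<length Ys}. Y j \<inter> traces_upto \<theta> B n = {}"
    by (rule bracketing_localE[OF br B, of n])
  obtain i where i: "i \<in> I" "t \<in> Y i" using t by blast
  then have "i \<in> \<phi> ` {..<length Ys}" using \<phi>(2) tT by blast
  then obtain k where "k < length Ys" "i = \<phi> k" by blast
  then have "t \<in> Ys ! k" using \<phi>(1) i tT by blast
  then have "t \<in> \<Union>(set Ys)" using \<open>k < length Ys\<close> by (meson UnionI nth_mem)
  moreover from this have "P t = finite_bracketing A \<theta> f t" using P tT by blast
  ultimately show ?thesis using homogeneous_finite_bracketing[OF Ys] by simp
qed

text \<open>
The local model is chosen for the finitely many traces in the support of the given element, which is
thereby unchanged by the truncation.
\<close>

lemma free_pc_lie_subset_span_bracketing: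
  fixes P :: "'a trace \<Rightarrow> ('a trace \<Rightarrow>\<^sub>0 'k::comm_ring_1)"
  assumes br: "bracketing A \<theta> I (\<lambda>i. {l i}) P"
  shows "free_pc_lie A \<theta> \<subseteq> pm.span ((\<lambda>i. P (l i)) ` I)" (is "_ \<subseteq> ?W")
proof
  fix p :: "'a trace \<Rightarrow>\<^sub>0 'k" assume "p \<in> free_pc_lie A \<theta>"
  then have p: "p \<in> lie_closed M hull ((\<lambda>t. Poly_Mapping.single t (1::'k)) ` letters A \<theta>)"
    by (simp only: free_pc_lie_eq)
  have keys: "Poly_Mapping.keys p \<subseteq> carrier M" using p by (rule keys_lie_hull_letters)
  define B where "B = (\<Union>t\<in>Poly_Mapping.keys p. set_mset (multidegree t))"
  define n where "n = (\<Sum>t\<in>Poly_Mapping.keys p. size (multidegree t))"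
  define T where "T = traces_upto \<theta> B n"
  have "finite B" by (simp add: B_def)
  moreover have "B \<subseteq> A" using keys by (fastforce simp: B_def elim: carrierE)
  ultimately obtain Ys f \<phi> where Ys: "bisections_compose A \<theta> f Ys"
    and P: "\<forall>t \<in> \<Union>(set Ys) \<inter> T. P t = finite_bracketing A \<theta> f t"
    and \<phi>: "\<phi> ` {..<length Ys} \<subseteq> I" "\<forall>k<length Ys. Ys ! k \<inter> T = {l (\<phi> k)} \<inter> T"
    unfolding T_def by (rule bracketing_localE[OF br, of B n])
  let ?g = "finite_bracketing A \<theta> f :: 'a trace \<Rightarrow> ('a trace \<Rightarrow>\<^sub>0 'k)"
  have "restrict_keys T q \<in> ?W" if Y: "Y \<in> set Ys" and q: "q \<in> lie_closed M hull (?g ` Y)" for Y q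
  proof -
    obtain k where k: "k < length Ys" "Y = Ys ! k" using Y by (metis in_set_conv_nth)
    have YT: "Y \<inter> T \<subseteq> {l (\<phi> k)}" using \<phi>(2) k by blast
    have "homogeneous (?g y) (multidegree y)" if "y \<in> Y" for y
      using homogeneous_finite_bracketing[OF Ys] Y that by blast
    moreover have "Y \<subseteq> carrier M" using bisections_compose_invariants[OF Ys] Y by blast
    ultimately have "restrict_keys T q \<in> pm.span (?g ` (Y \<inter> T))"
      using T_def YT q by (rule restrict_keys_lie_hull)
    moreover have "?g ` (Y \<inter> T) \<subseteq> (\<lambda>i. P (l i)) ` I"
    proof
      fix x assume "x \<in> ?g ` (Y \<inter> T)"
      then obtain y where y: "y \<in> Y \<inter> T" "x = ?g y" by blast
      then have "y = l (\<phi> k)" using YT by blast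
      moreover have "P y = ?g y" using P Y y(1) by blast
      then have "x = P y" using y(2) by simp
      ultimately show "x \<in> (\<lambda>i. P (l i)) ` I" using \<phi>(1) k(1) by auto
    qed
    ultimately show ?thesis using pm.span_mono by blast
  qed
  then have "pm.span (\<Union>Y\<in>set Ys. lie_closed M hull (?g ` Y)) \<subseteq> {q. restrict_keys T q \<in> ?W}"
    by (intro pm.span_minimal subspace_restrict_keys_preimage pm.subspace_span) blast
  then have "restrict_keys T p \<in> ?W" using lie_hull_letters_subset[OF Ys] p by blast
  moreover have "restrict_keys T p = p"
  proof (intro restrict_keys_id subsetI)
    fix t assume t: "t \<in> Poly_Mapping.keys p"
    then show "t \<in> T"
      unfolding T_def using keys member_le_sum[OF t, of "\<lambda>t. size (multidegree t)"]
      by (subst traces_upto_iff) (auto simp: B_def n_def)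
  qed
  ultimately show "p \<in> ?W" by simp
qed

end

section \<open>Sorted products in complete factorizations\<close>

lemma sorted_concat_replicate:
  "sorted_wrt (<) ks \<Longrightarrow> sorted (concat (map (\<lambda>i. replicate (k i) i) ks))"
  by (induction ks) (auto simp: sorted_append intro: order_less_imp_le)

lemma count_concat_replicate:
  "distinct ks \<Longrightarrow> count (mset (concat (map (\<lambda>i. replicate (k i) i) ks))) x = (if x \<in> set ks then k x else 0)"
  by (induction ks) auto

text \<open>
A sorted list is the concatenation of its blocks of equal entries, in increasing order. The blocks correspond
to the factors in a factorization of a monoid.
\<close>

lemma sorted_eq_concat_replicate:
  fixes xs :: "'i::linorder list"
  assumes "sorted xs"
  shows "concat (map (\<lambda>i. replicate (count (mset xs) i) i) (sorted_list_of_set (set xs))) = xs"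
    (is "?ys = xs")
proof -
  have "mset ?ys = mset xs"
    by (rule multiset_eqI) (auto simp: count_concat_replicate count_eq_zero_iff)
  moreover have "sorted ?ys" by (rule sorted_concat_replicate) simp
  ultimately have "sort xs = ?ys" by (rule properties_for_sort)
  then show ?thesis using assms by (simp add: sorted_sort_id)
qed

context trace_algebra
begin

lemma list_prod_concat:
  "(\<And>ys. ys \<in> set yss \<Longrightarrow> set ys \<subseteq> carrier M) \<Longrightarrow>
    list_prod M (map (list_prod M) yss) = list_prod M (concat yss)"
proof (induction yss)
  case (Cons ys yss)
  have "set ys \<subseteq> carrier M" "set (concat yss) \<subseteq> carrier M" using Cons.prems by fastforce+
  then have "list_prod M (ys @ concat yss) = list_prod M ys \<otimes>\<^bsub>M\<^esub> list_prod M (concat yss)"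
    by (rule list_prod_append)
  then show ?case using Cons by simp
qed simp

lemma multidegree_list_prod_replicate:
  assumes "t \<in> carrier M"
  shows "size (multidegree (list_prod M (replicate k t))) = k * size (multidegree t)"
proof -
  have "set (replicate k t) \<subseteq> carrier M" using assms by auto
  then have "multidegree (list_prod M (replicate k t)) = (\<Sum>x\<leftarrow>replicate k t. multidegree x)"
    by (rule multidegree_list_prod)
  moreover have "size (\<Sum>x\<leftarrow>replicate k t. multidegree x) = k * size (multidegree t)"
    by (induction k) simp_all
  ultimately show ?thesis by simp
qed

text \<open>
The empty set and \<open>{1}\<close> generate the same submonoid, so minimality excludes the generator \<open>1\<close>.
\<close>

lemma complete_generator_nontrivial:
  assumes "trace_factorization A \<theta> I (\<lambda>i. {l i})" "i \<in> I"
  shows "l i \<in> carrier M" "multidegree (l i) \<noteq> {#}"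
proof -
  have min: "minimal_generators M {l i}" using assms by (simp add: trace_factorization_def)
  then show l: "l i \<in> carrier M" by (simp add: minimal_generators_def)
  have "{} \<subset> {l i}" by blast
  then have ne: "gen_submonoid M {} \<noteq> gen_submonoid M {l i}"
    using min unfolding minimal_generators_def by blast
  have one: "list_prod M xs = \<one>\<^bsub>M\<^esub>" if "set xs \<subseteq> {\<one>\<^bsub>M\<^esub>}" for xs
    using that by (induction xs) auto
  have "gen_submonoid M X = {\<one>\<^bsub>M\<^esub>}" if "X \<subseteq> {\<one>\<^bsub>M\<^esub>}" for X
  proof
    show "gen_submonoid M X \<subseteq> {\<one>\<^bsub>M\<^esub>}"
      unfolding gen_submonoid_def using one that by blast
    have "list_prod M [] \<in> gen_submonoid M X"
      unfolding gen_submonoid_def by (intro imageI) simp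
    then show "{\<one>\<^bsub>M\<^esub>} \<subseteq> gen_submonoid M X" by simp
  qed
  then have "gen_submonoid M {} = gen_submonoid M {\<one>\<^bsub>M\<^esub>}" by simp
  with ne show "multidegree (l i) \<noteq> {#}" using l by (metis multidegree_empty_iff)
qed

text \<open>
Collecting equal factors of a sorted product into powers gives a factorization with one element in each
of the submonoids \<open>\<langle>l\<^sub>i\<rangle>\<close>. It is unique by hypothesis, and the lengths recover the exponents
because \<open>l\<^sub>i \<noteq> 1\<close>.
\<close>

lemma sorted_product_inj:
  fixes l :: "'i::linorder \<Rightarrow> 'a trace"
  assumes fact: "trace_factorization A \<theta> I (\<lambda>i. {l i})"
    and xs: "xs \<in> lists I" "sorted xs" and ys: "ys \<in> lists I" "sorted ys"
    and eq: "list_prod M (map l xs) = list_prod M (map l ys)"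
  shows "xs = ys"
proof -
  note l = complete_generator_nontrivial[OF fact]
  define block where "block zs i = list_prod M (replicate (count (mset zs) i) (l i))" for zs i
  define blocks where "blocks zs = map (\<lambda>i. (i, block zs i)) (sorted_list_of_set (set zs))" for zs
  have size_block: "size (multidegree (block zs i)) = count (mset zs) i * size (multidegree (l i))"
    if "i \<in> I" for zs i
    unfolding block_def using l(1)[OF that] by (rule multidegree_list_prod_replicate)
  have carrier: "set (map l zs) \<subseteq> carrier M" if "zs \<in> lists I" for zs using that l(1) by auto
  have blocks: "sorted_wrt (<) (map fst (blocks zs)) \<and>
      (\<forall>(i, x)\<in>set (blocks zs). i \<in> I \<and> x \<in> gen_submonoid M {l i} - {\<one>\<^bsub>M\<^esub>}) \<and>
      list_prod M (map l zs) = list_prod M (map snd (blocks zs))"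
    if zs: "zs \<in> lists I" "sorted zs" for zs
  proof (intro conjI)
    show "sorted_wrt (<) (map fst (blocks zs))" by (simp add: blocks_def comp_def)
    have "i \<in> I \<and> block zs i \<in> gen_submonoid M {l i} - {\<one>\<^bsub>M\<^esub>}" if "i \<in> set zs" for i
    proof -
      have i: "i \<in> I" using that zs by auto
      have "block zs i \<in> gen_submonoid M {l i}"
        unfolding block_def gen_submonoid_def by (intro imageI) auto
      moreover have "size (multidegree (block zs i)) \<noteq> 0"
        unfolding size_block[OF i] using l(2)[OF i] that by (simp add: count_eq_zero_iff)
      then have "block zs i \<noteq> \<one>\<^bsub>M\<^esub>" by (auto simp: one_trace_monoid)
      ultimately show ?thesis using i by blast
    qed
    then show "\<forall>(i, x)\<in>set (blocks zs). i \<in> I \<and> x \<in> gen_submonoid M {l i} - {\<one>\<^bsub>M\<^esub>}"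
      by (auto simp: blocks_def)
    let ?yss = "map (\<lambda>i. replicate (count (mset zs) i) (l i)) (sorted_list_of_set (set zs))"
    have "map snd (blocks zs) = map (list_prod M) ?yss" by (simp add: blocks_def block_def)
    moreover have "list_prod M (map (list_prod M) ?yss) = list_prod M (concat ?yss)"
      by (rule list_prod_concat) (use zs l(1) in auto)
    moreover have "concat ?yss = map l zs"
      by (subst (2) sorted_eq_concat_replicate[OF zs(2), symmetric]) (simp add: map_concat comp_def)
    ultimately show "list_prod M (map l zs) = list_prod M (map snd (blocks zs))" by simp
  qed
  show ?thesis
  proof (cases "list_prod M (map l xs) = \<one>\<^bsub>M\<^esub>")
    case True
    have "zs = []" if "list_prod M (map l zs) = \<one>\<^bsub>M\<^esub>" "zs \<in> lists I" for zs
    proof -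
      have "(\<Sum>z\<leftarrow>map l zs. multidegree z) = {#}"
        using multidegree_list_prod[OF carrier[OF that(2)]] that(1) by (simp add: one_trace_monoid)
      then show ?thesis using that(2) l(2) by (cases zs) auto
    qed
    from this[OF True xs(1)] this[of ys] show ?thesis using True eq ys(1) by simp
  next
    case False
    define Q where "Q = (\<lambda>ms. sorted_wrt (<) (map fst ms) \<and>
            (\<forall>(i, x) \<in> set ms. i \<in> I \<and> x \<in> gen_submonoid M {l i} - {\<one>\<^bsub>M\<^esub>}) \<and>
            list_prod M (map l xs) = list_prod M (map snd ms))"
    have "list_prod M (map l xs) \<in> carrier M - {\<one>\<^bsub>M\<^esub>}"
      using list_prod_closed[OF carrier[OF xs(1)]] False by simp
    moreover have "\<forall>m\<in>carrier M - {\<one>\<^bsub>M\<^esub>}. \<exists>!ms. sorted_wrt (<) (map fst ms) \<and>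
            (\<forall>(i, x) \<in> set ms. i \<in> I \<and> x \<in> gen_submonoid M {l i} - {\<one>\<^bsub>M\<^esub>}) \<and>
            m = list_prod M (map snd ms)"
      using fact unfolding trace_factorization_def factorization_def by (elim conjE)
    ultimately have "\<exists>!ms. Q ms" unfolding Q_def by (rule bspec[rotated])
    moreover have "Q (blocks xs)" "Q (blocks ys)"
      unfolding Q_def by (rule blocks[OF xs], unfold eq, rule blocks[OF ys])
    ultimately have bl: "blocks xs = blocks ys" by blast
    have "map fst (blocks zs) = sorted_list_of_set (set zs)" for zs by (simp add: blocks_def comp_def)
    then have "sorted_list_of_set (set xs) = sorted_list_of_set (set ys)" using bl by metis
    then have set: "set xs = set ys" by (metis List.finite_set set_sorted_list_of_set)
    have "count (mset xs) i = count (mset ys) i" for i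
    proof (cases "i \<in> set xs")
      case True
      then have i: "i \<in> I" using xs by auto
      have "block xs i = block ys i" using bl True unfolding blocks_def set by auto
      then have "count (mset xs) i * size (multidegree (l i)) = count (mset ys) i * size (multidegree (l i))"
        using size_block[OF i] by metis
      then show ?thesis using l(2)[OF i] by simp
    next
      case False
      then show ?thesis using set by (metis count_mset_0_iff)
    qed
    then have "mset xs = mset ys" by (rule multiset_eqI)
    then show ?thesis using xs(2) ys(2) by (metis properties_for_sort)
  qed
qed

section \<open>Independence: counting sorted products\<close>

lemma alg_mult_one_right:
  assumes "Poly_Mapping.keys p \<subseteq> carrier M"
  shows "alg_mult M p (Poly_Mapping.single \<one>\<^bsub>M\<^esub> 1) = p"
proof -
  have "alg_mult M p (Poly_Mapping.single \<one>\<^bsub>M\<^esub> 1)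
      = (\<Sum>s\<in>Poly_Mapping.keys p. \<Sum>t\<in>{\<one>\<^bsub>M\<^esub>}. Poly_Mapping.single (s \<otimes>\<^bsub>M\<^esub> t)
          (Poly_Mapping.lookup p s * Poly_Mapping.lookup (Poly_Mapping.single \<one>\<^bsub>M\<^esub> 1) t))"
    by (rule alg_mult_eq_sum) auto
  also have "\<dots> = (\<Sum>s\<in>Poly_Mapping.keys p. Poly_Mapping.single s (Poly_Mapping.lookup p s))"
    using assms by (intro sum.cong) (auto simp: subset_iff)
  also have "\<dots> = p"
    by (rule poly_mapping_eq_sum_single[OF finite_keys order_refl, symmetric])
  finally show ?thesis .
qed

lemma alg_mult_in_span_products:
  assumes "p \<in> pm.span (g ` I)" "q \<in> pm.span ((\<lambda>js. ordered_product g js u) ` lists I)"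
  shows "alg_mult M p q \<in> pm.span ((\<lambda>js. ordered_product g js u) ` lists I)" (is "_ \<in> ?S")
  using assms(1)
proof (induction p rule: pm.span_induct_alt)
  case (step c x y)
  then obtain i where i: "i \<in> I" "x = g i" by blast
  have "alg_mult M x q \<in> ?S"
    using assms(2)
  proof (induction q rule: pm.span_induct_alt)
    case (step d z w)
    then obtain js where js: "js \<in> lists I" "z = ordered_product g js u" by blast
    then have "alg_mult M x z = ordered_product g (i # js) u" using i by simp
    moreover have "i # js \<in> lists I" using i js by simp
    ultimately have "alg_mult M x z \<in> ?S" by (intro pm.span_base) (metis imageI)
    then show ?case using step by (simp add: alg_mult_add_right alg_mult_scale_right pm.span_add pm.span_scale)
  qed (simp add: pm.span_zero)
  then show ?case using step by (simp add: alg_mult_add_left alg_mult_scale_left pm.span_add pm.span_scale)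
qed (simp add: pm.span_zero)

text \<open>
A trace is a product of letters, the letters are combinations of the \<open>g i\<close>, and the products
that arise from multiplying out are straightened.
\<close>

lemma trace_in_span_sorted_products:
  fixes g :: "'i::linorder \<Rightarrow> ('a trace \<Rightarrow>\<^sub>0 'k::comm_ring_1)"
  assumes letters: "\<And>t. t \<in> letters A \<theta> \<Longrightarrow> Poly_Mapping.single t 1 \<in> pm.span (g ` I)"
    and br: "\<And>i j. i \<in> I \<Longrightarrow> j \<in> I \<Longrightarrow> lie_bracket M (g i) (g j) \<in> pm.span (g ` I)"
    and t: "t \<in> carrier M"
  shows "Poly_Mapping.single t 1 \<in>
    pm.span ((\<lambda>js. ordered_product g js (Poly_Mapping.single \<one>\<^bsub>M\<^esub> 1)) ` {js \<in> lists I. sorted js})"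
proof -
  let ?u = "Poly_Mapping.single \<one>\<^bsub>M\<^esub> (1::'k)"
  let ?S = "pm.span ((\<lambda>js. ordered_product g js ?u) ` lists I)"
  obtain w where w: "w \<in> lists A" "t = trace_of \<theta> w" using t by (rule carrierE)
  have "Poly_Mapping.single (trace_of \<theta> w) 1 \<in> ?S" using w(1)
  proof (induction w)
    case Nil
    have "ordered_product g [] ?u \<in> ?S" by (rule pm.span_base, rule imageI) simp
    then show ?case by (simp add: one_trace_monoid)
  next
    case (Cons a w)
    have "alg_mult M (Poly_Mapping.single (trace_of \<theta> [a]) 1) (Poly_Mapping.single (trace_of \<theta> w) 1) \<in> ?S"
      using Cons by (intro alg_mult_in_span_products letters) (auto simp: letters_def)
    then show ?case by (simp add: alg_mult_single)
  qed
  moreover have "?S \<subseteq> pm.span ((\<lambda>js. ordered_product g js ?u) ` {js \<in> lists I. sorted js})"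
    using ordered_product_in_span_sorted[OF br] by (intro pm.span_minimal) auto
  ultimately show ?thesis using w(2) by blast
qed

lemma homogeneous_ordered_product:
  assumes "\<And>i. i \<in> set is \<Longrightarrow> homogeneous (g i) (multidegree (l i)) \<and> l i \<in> carrier M"
  shows "homogeneous (ordered_product g is (Poly_Mapping.single \<one>\<^bsub>M\<^esub> 1)) (multidegree (list_prod M (map l is)))"
  using assms
proof (induction "is")
  case Nil
  show ?case using homogeneous_single[OF one_closed] by simp
next
  case (Cons i "is")
  have "set (map l is) \<subseteq> carrier M" using Cons.prems by auto
  then have "multidegree (list_prod M (map l (i # is))) = multidegree (l i) + multidegree (list_prod M (map l is))"
    using Cons.prems by (simp add: multidegree_mult list_prod_closed)
  moreover have "homogeneous (g i) (multidegree (l i))"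
    "homogeneous (ordered_product g is (Poly_Mapping.single \<one>\<^bsub>M\<^esub> 1)) (multidegree (list_prod M (map l is)))"
    using Cons by auto
  ultimately show ?case unfolding ordered_product_simps by (simp only: homogeneous_alg_mult)
qed

text \<open>
For finitely many indices \<open>J\<close>, let \<open>T\<close> be a finite set of traces, closed under taking all traces of the same
multidegree, that contains the \<open>l i\<close> with \<open>i \<in> J\<close>. Each sorted product of the \<open>g i\<close> is attached to the trace
\<open>lead js\<close> given by the corresponding product of the \<open>l i\<close>, from which it can be recovered. This yields a
family \<open>v\<close> indexed by traces. After truncation, its members with index in \<open>T\<close> generate all traces in \<open>T\<close>,
hence are independent, and they include the \<open>g i\<close> with \<open>i \<in> J\<close>.
\<close>

lemma complete_family_independent:
  fixes g :: "'i::linorder \<Rightarrow> ('a trace \<Rightarrow>\<^sub>0 'k::comm_ring_1)"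
  assumes fact: "trace_factorization A \<theta> I (\<lambda>i. {l i})"
    and hom: "\<And>i. i \<in> I \<Longrightarrow> homogeneous (g i) (multidegree (l i))"
    and letters: "\<And>t. t \<in> letters A \<theta> \<Longrightarrow> Poly_Mapping.single t 1 \<in> pm.span (g ` I)"
    and br: "\<And>i j. i \<in> I \<Longrightarrow> j \<in> I \<Longrightarrow> lie_bracket M (g i) (g j) \<in> pm.span (g ` I)"
    and J: "finite J" "J \<subseteq> I" and c: "(\<Sum>i\<in>J. pm_scale (c i) (g i)) = 0" and "i \<in> J"
  shows "c i = 0"
proof -
  note l = complete_generator_nontrivial[OF fact]
  define prod where "prod js = ordered_product g js (Poly_Mapping.single \<one>\<^bsub>M\<^esub> 1)" for js
  define lead where "lead js = list_prod M (map l js)" for js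
  define S where "S = {js \<in> lists I. sorted js}"
  define B where "B = (\<Union>i\<in>J. set_mset (multidegree (l i)))"
  define n where "n = (\<Sum>i\<in>J. size (multidegree (l i)))"
  define T where "T = traces_upto \<theta> B n"
  have lead_inj: "inj_on lead S"
    using sorted_product_inj[OF fact] by (auto simp: inj_on_def S_def lead_def)
  have lead_single: "lead [i] = l i" if "i \<in> I" for i using l(1)[OF that] by (simp add: lead_def)
  have l_inj: "inj_on l I"
  proof (rule inj_onI)
    fix i j assume ij: "i \<in> I" "j \<in> I" "l i = l j"
    then have "[i] = [j]"
      by (intro inj_onD[OF lead_inj]) (simp_all add: lead_single S_def)
    then show "i = j" by simp
  qed
  have prod_hom: "homogeneous (prod js) (multidegree (lead js))" if "js \<in> S" for js
    unfolding prod_def lead_def by (rule homogeneous_ordered_product) (use that hom l S_def in auto)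
  have lead_closed: "lead js \<in> carrier M" if "js \<in> S" for js
    unfolding lead_def using that l(1) by (intro list_prod_closed) (auto simp: S_def)
  have prod_single: "prod [i] = g i" if "i \<in> I" for i
    using hom[OF that] unfolding prod_def by (simp add: alg_mult_one_right homogeneous_def subset_iff)
  have "B \<subseteq> A" using J l(1) by (fastforce simp: B_def elim: carrierE)
  then have TM: "T \<subseteq> carrier M" unfolding T_def by (rule traces_upto_subset)
  have "finite B" using J by (simp add: B_def)
  then have T_fin: "finite T" unfolding T_def by (rule finite_traces_upto)
  have lT: "l j \<in> T" if "j \<in> J" for j
    unfolding T_def using that J l(1) member_le_sum[OF that, of "\<lambda>i. size (multidegree (l i))"]
    by (subst traces_upto_iff) (auto simp: B_def n_def)
  \<comment> \<open>Traces that are not the leading trace of a sorted product receive the vector zero,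
      so that the family is square without surjectivity of \<open>lead\<close>.\<close>
  define v where "v t = (if t \<in> lead ` S then prod (the_inv_into S lead t) else 0)" for t
  have v_lead: "v (lead js) = prod js" if "js \<in> S" for js
    using that lead_inj by (simp add: v_def the_inv_into_f_f)
  have v_l: "v (l i) = g i" if "i \<in> I" for i
    using v_lead[of "[i]"] that by (simp add: S_def lead_single prod_single)
  have restrict_prod: "restrict_keys T (prod js) \<in> pm.span (v ` T)" if js: "js \<in> S" for js
  proof -
    have keys: "t \<in> T \<longleftrightarrow> lead js \<in> T" if "t \<in> Poly_Mapping.keys (prod js)" for t
      using prod_hom[OF js] lead_closed[OF js] that by (auto simp: homogeneous_def T_def traces_upto_iff)
    show ?thesis
    proof (cases "lead js \<in> T")
      case True
      then have "restrict_keys T (prod js) = v (lead js)"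
        using keys v_lead[OF js] by (subst restrict_keys_id) auto
      then show ?thesis using True by (auto intro: pm.span_base)
    next
      case False
      then have "restrict_keys T (prod js) = 0" using keys by (intro restrict_keys_disjoint) blast
      then show ?thesis by (simp add: pm.span_zero)
    qed
  qed
  have v_span: "Poly_Mapping.single t 1 \<in> pm.span (v ` T)" if t: "t \<in> T" for t
  proof -
    have "Poly_Mapping.single t 1 \<in> pm.span (prod ` S)"
      unfolding prod_def S_def using trace_in_span_sorted_products[OF letters br] t TM by blast
    moreover have "pm.span (prod ` S) \<subseteq> {p. restrict_keys T p \<in> pm.span (v ` T)}"
      using restrict_prod by (intro pm.span_minimal subspace_restrict_keys_preimage pm.subspace_span) blast
    ultimately have "restrict_keys T (Poly_Mapping.single t (1::'k)) \<in> pm.span (v ` T)" by blast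
    then show ?thesis using t by (subst (asm) restrict_keys_id) auto
  qed
  define x where "x t = (if t \<in> l ` J then c (the_inv_into J l t) else 0)" for t
  have lJ: "inj_on l J" using l_inj J(2) by (rule inj_on_subset)
  have x_l: "x (l i) = c i" if "i \<in> J" for i using that lJ by (simp add: x_def the_inv_into_f_f)
  have "(\<Sum>t\<in>T. pm_scale (x t) (v t)) = (\<Sum>t\<in>l ` J. pm_scale (x t) (v t))"
    using lT T_fin by (intro sum.mono_neutral_right) (auto simp: x_def)
  also have "\<dots> = (\<Sum>i\<in>J. pm_scale (c i) (g i))"
    unfolding sum.reindex[OF lJ] comp_def by (intro sum.cong) (use x_l v_l J in auto)
  finally have "(\<Sum>t\<in>T. pm_scale (x t) (v t)) = 0" using c by simp
  then have "x (l i) = 0"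
    using square_spanning_family_independent[OF T_fin v_span] lT \<open>i \<in> J\<close> by blast
  then show ?thesis using x_l \<open>i \<in> J\<close> by simp
qed

end

section \<open>The basis theorem\<close>

theorem proposition26:
  fixes A :: "'a set" and \<theta> :: "('a \<times> 'a) set"
    and I :: "'i::linorder set" and l :: "'i \<Rightarrow> 'a trace"
    and P :: "'a trace \<Rightarrow> ('a trace \<Rightarrow>\<^sub>0 'k::comm_ring_1)"
  assumes "independence_alphabet A \<theta>"
    and "locally_transitive_finite A \<theta> I (\<lambda>i. {l i})"
    and "bracketing A \<theta> I (\<lambda>i. {l i}) P"
  shows "family_basis I (\<lambda>i. P (l i)) (free_pc_lie A \<theta>)"
proof -
  interpret trace_algebra A \<theta> by unfold_locales (rule assms(1))
  let ?g = "\<lambda>i. P (l i)"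
  let ?L = "free_pc_lie A \<theta> :: ('a trace \<Rightarrow>\<^sub>0 'k) set"
  have fact: "trace_factorization A \<theta> I (\<lambda>i. {l i})"
    using assms(2) by (simp add: locally_transitive_finite_def)
  have L: "lie_closed M ?L" unfolding free_pc_lie_eq by (rule lie_closed_hull)
  have gL: "?g i \<in> ?L" if "i \<in> I" for i
    using assms(3) that unfolding bracketing_def by blast
  have span: "pm.span (?g ` I) = ?L"
  proof
    show "pm.span (?g ` I) \<subseteq> ?L"
      using L gL by (intro pm.span_minimal) (auto simp: lie_closed_def)
    show "?L \<subseteq> pm.span (?g ` I)" by (rule free_pc_lie_subset_span_bracketing[OF assms(3)])
  qed
  show ?thesis
  proof (rule family_basisI[OF span])
    have hom: "homogeneous (?g i) (multidegree (l i))" if "i \<in> I" for i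
      using that complete_generator_nontrivial(1)[OF fact that]
      by (intro bracketing_homogeneous[OF assms(3)]) auto
    have letters: "Poly_Mapping.single t 1 \<in> pm.span (?g ` I)" if "t \<in> letters A \<theta>" for t
      unfolding span free_pc_lie_eq using that by (intro hull_inc) blast
    have bracket: "lie_bracket M (?g i) (?g j) \<in> pm.span (?g ` I)" if "i \<in> I" "j \<in> I" for i j
      unfolding span using L gL that by (simp add: lie_closed_def)
    show "c i = 0"
      if "finite J" "J \<subseteq> I" "(\<Sum>i\<in>J. pm_scale (c i) (?g i)) = 0" "i \<in> J" for J c i
      using complete_family_independent[OF fact hom letters bracket that] .
  qed
qed

end
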